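(* Let $\mu\in\mathbb{C}$ with $2\mu\notin\mathbb{Z}$ and $y_0'\in\mathbb{C}\setminus\{0,1\}$ (with fixed square roots $\sqrt{y_0'}$, $\sqrt{1-y_0'}$). Consider the system $$\frac{d\widetilde Y}{dz}=\left[\frac12\begin{pmatrix}1&0&1\\0&0&0\\1&0&1\end{pmatrix}+\frac{\mu}{z}\begin{pmatrix}1&0&0\\0&0&0\\0&0&-1\end{pmatrix}\right]\widetilde Y .$$ Let $\widetilde Y^{(0)}(z)=(I+\sum_{k\ge1}G_kz^k)\,\mathrm{diag}(z^\mu,1,z^{-\mu})$ be its fundamental solution at $z=0$ and let $\widetilde Y_1(z)$ be its fundamental solution such that $$\Psi\,\widetilde Y_1(z)\sim (I+O(1/z))\,\mathrm{diag}(1,1,e^z),\quad z\to\infty,\ -\tfrac{3\pi}{2}<\arg z<\tfrac{\pi}{2}.$$ Then the central connection matrix $\mathcal{C}^{(0)}$, defined by $\widetilde Y_1(z)=\widetilde Y^{(0)}(z)\,\mathcal{C}^{(0)}$, has entries \begin{align*} &\mathcal{C}^{(0)}_{11}=-i\frac{\sqrt{2\pi}\sqrt{y_0'}}{2^{1+2\mu}}\frac{\sec(\mu\pi)}{\Gamma(\frac12+\mu)},\quad \mathcal{C}^{(0)}_{12}=-i\frac{\sqrt{2\pi}\sqrt{1-y_0'}}{2^{1+2\mu}}\frac{\sec(\mu\pi)}{\Gamma(\frac12+\mu)},\quad \mathcal{C}^{(0)}_{13}=\frac{\sqrt{2\pi}}{2^{1+2\mu}}\frac{\sec(\mu\pi)}{\Gamma(\frac12+\mu)}e^{i\mu\pi},\\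 &\mathcal{C}^{(0)}_{21}=-\sqrt{1-y_0'},\quad \mathcal{C}^{(0)}_{22}=\sqrt{y_0'},\quad \mathcal{C}^{(0)}_{23}=0,\\ &\mathcal{C}^{(0)}_{31}=i(1-2\mu)\frac{\sqrt{2\pi}\sqrt{y_0'}}{2^{2(1-\mu)}}\frac{\sec(\mu\pi)}{\Gamma(\frac32-\mu)},\quad \mathcal{C}^{(0)}_{32}=i(1-2\mu)\frac{\sqrt{2\pi}\sqrt{1-y_0'}}{2^{2(1-\mu)}}\frac{\sec(\mu\pi)}{\Gamma(\frac32-\mu)},\\ &\mathcal{C}^{(0)}_{33}=(1-2\mu)\frac{\sqrt{2\pi}}{2^{2(1-\mu)}}\frac{\sec(\mu\pi)}{\Gamma(\frac32-\mu)}e^{-i\mu\pi}. \end{align*}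
   Context: $$\Psi=\begin{pmatrix} i\sqrt{y_0'}/\sqrt2&-\sqrt{1-y_0'}&-i\sqrt{y_0'}/\sqrt2\\ i\sqrt{1-y_0'}/\sqrt2&\sqrt{y_0'}&-i\sqrt{1-y_0'}/\sqrt2\\ 1/\sqrt2&0&1/\sqrt2\end{pmatrix}.$$ The powers $z^{\pm\mu}=e^{\pm\mu\log z}$ are defined on the universal covering of $\mathbb{C}\setminus\{0\}$, with $\log z=\log|z|+i\arg z$ and the same determination of $\arg z$ used in the sector $-\frac{3\pi}2<\arg z<\frac\pi2$. Since $2\mu\notin\mathbb{Z}$, $\widetilde Y^{(0)}$ (with convergent power series) and $\widetilde Y_1$ exist and are unique. The system is obtained by $Y=\Psi\widetilde Y$ from $\frac{dY}{dz}=(\mathrm{diag}(0,0,1)+\Omega_0/z)Y$, $\Omega_0=\Psi\,\mathrm{diag}(\mu,0,-\mu)\Psi^{-1}$. *)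

theory Defs
  imports "HOL-Analysis.Analysis" "HOL-Library.Landau_Symbols"
begin

text \<open>
  The universal covering of \<open>\<complex> - {0}\<close> is represented by \<open>exp : \<complex> \<rightarrow> \<complex> - {0}\<close>.  A point of the
  covering is a complex number \<open>\<zeta>\<close>, to be read as \<open>\<zeta> = log z = log |z| + i arg z\<close>; thus it lies
  over \<open>z = exp \<zeta>\<close>, with \<open>|z| = exp (Re \<zeta>)\<close>, \<open>arg z = Im \<zeta>\<close> and \<open>z\<^sup>\<mu> = exp (\<mu> * \<zeta>)\<close>.
  Functions of \<open>z\<close> on the covering are functions of \<open>\<zeta>\<close> on \<open>\<complex>\<close>.
\<close>

definition diag3 :: "complex \<Rightarrow> complex \<Rightarrow> complex \<Rightarrow> complex^3^3" where
  "diag3 a b c = vector [vector [a, 0, 0], vector [0, b, 0], vector [0, 0, c]]"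

definition coeff_matrix :: "complex \<Rightarrow> complex \<Rightarrow> complex^3^3" where
  "coeff_matrix \<mu> z =
     mat (1/2) ** vector [vector [1, 0, 1], vector [0, 0, 0], vector [1, 0, 1]]
     + mat (\<mu> / z) ** diag3 1 0 (- 1)"

text \<open>The factor \<open>exp \<zeta>\<close> is \<open>dz/d\<zeta>\<close>: the equation \<open>dY/dz = A(z) Y\<close> reads
  \<open>dY/d\<zeta> = exp \<zeta> A(exp \<zeta>) Y\<close> in the coordinate \<open>\<zeta>\<close>.\<close>

definition fundamental_solution :: "complex \<Rightarrow> (complex \<Rightarrow> complex^3^3) \<Rightarrow> bool" where
  "fundamental_solution \<mu> Y \<longleftrightarrow>
     (\<forall>\<zeta> i j. ((\<lambda>\<xi>. Y \<xi> $ i $ j) has_field_derivative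
                exp \<zeta> * (coeff_matrix \<mu> (exp \<zeta>) ** Y \<zeta>) $ i $ j) (at \<zeta>))
     \<and> (\<forall>\<zeta>. invertible (Y \<zeta>))"

text \<open>The power series is only required to converge, and to represent the solution, near
  \<open>z = 0\<close>.\<close>

definition fundamental_solution_at_0 :: "complex \<Rightarrow> (complex \<Rightarrow> complex^3^3) \<Rightarrow> bool" where
  "fundamental_solution_at_0 \<mu> Y \<longleftrightarrow>
     fundamental_solution \<mu> Y
     \<and> (\<exists>(G :: nat \<Rightarrow> complex^3^3) (P :: complex \<Rightarrow> complex^3^3) (r :: real).
          G 0 = mat 1 \<and> r > 0
          \<and> (\<forall>z. norm z < r \<longrightarrow> (\<lambda>k. mat (z ^ k) ** G k) sums P z)
          \<and> (\<forall>\<zeta>. norm (exp \<zeta>) < r \<longrightarrow>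
                Y \<zeta> = P (exp \<zeta>) ** diag3 (exp (\<mu> * \<zeta>)) 1 (exp (- \<mu> * \<zeta>))))"

text \<open>\<open>s\<close> and \<open>t\<close> are the chosen square roots of \<open>y\<^sub>0'\<close> and \<open>1 - y\<^sub>0'\<close>.\<close>

definition Psi :: "complex \<Rightarrow> complex \<Rightarrow> complex^3^3" where
  "Psi s t = vector
     [vector [\<i> * s / of_real (sqrt 2), - t, - \<i> * s / of_real (sqrt 2)],
      vector [\<i> * t / of_real (sqrt 2), s, - \<i> * t / of_real (sqrt 2)],
      vector [1 / of_real (sqrt 2), 0, 1 / of_real (sqrt 2)]]"

text \<open>\<open>|z| \<rightarrow> \<infinity>\<close> within the closed sector \<open>a \<le> arg z \<le> b\<close>.\<close>

definition at_infinity_in_sector :: "real \<Rightarrow> real \<Rightarrow> complex filter" where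
  "at_infinity_in_sector a b =
     inf (filtercomap Re at_top) (principal {\<zeta>. a \<le> Im \<zeta> \<and> Im \<zeta> \<le> b})"

text \<open>As usual for asymptotics in an open sector, \<open>O(1/z)\<close> is meant uniformly on every closed
  subsector; near the boundary ray \<open>arg z = \<pi>/2\<close> a bound that is uniform on the
  whole open sector would in general fail.\<close>

definition fundamental_solution_at_infinity ::
    "complex \<Rightarrow> complex \<Rightarrow> complex \<Rightarrow> (complex \<Rightarrow> complex^3^3) \<Rightarrow> bool" where
  "fundamental_solution_at_infinity \<mu> s t Y \<longleftrightarrow>
     fundamental_solution \<mu> Y
     \<and> (\<exists>E :: complex \<Rightarrow> complex^3^3.
          (\<forall>\<zeta>. Psi s t ** Y \<zeta> = (mat 1 + E \<zeta>) ** diag3 1 1 (exp (exp \<zeta>)))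
          \<and> (\<forall>a b. - 3 * pi / 2 < a \<longrightarrow> a \<le> b \<longrightarrow> b < pi / 2 \<longrightarrow>
               (\<forall>i j. (\<lambda>\<zeta>. E \<zeta> $ i $ j) \<in> O[at_infinity_in_sector a b](\<lambda>\<zeta>. 1 / exp \<zeta>))))"

definition connection_matrix ::
    "(complex \<Rightarrow> complex^3^3) \<Rightarrow> (complex \<Rightarrow> complex^3^3) \<Rightarrow> complex^3^3" where
  "connection_matrix Y0 Y1 = (THE C. \<forall>\<zeta>. Y1 \<zeta> = Y0 \<zeta> ** C)"

end

theory Submission
  imports Defs "HOL-Complex_Analysis.Complex_Analysis"
begin

text \<open>
  The second row decouples.  In \<open>p = y\<^sub>1 + y\<^sub>3\<close>, \<open>q = y\<^sub>1 - y\<^sub>3\<close> the system becomes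
  \<open>z p' = z p + \<mu> q\<close>, \<open>z q' = \<mu> p\<close>, and the solution with exponent \<open>\<mu>\<close> at \<open>0\<close> has
  \<open>p = z\<^sup>\<mu> F\<close>, \<open>F = \<^sub>1F\<^sub>1(1 + \<mu>; 1 + 2\<mu>; z)\<close>.  The coefficients of \<open>F\<close> are
  \<open>c\<^sub>n / n!\<close> with \<open>c\<^sub>n n\<^sup>\<mu> \<rightarrow> K = \<Gamma>(1 + 2\<mu>) / \<Gamma>(1 + \<mu>)\<close>, so an Abelian theorem for Poisson averages
  gives \<open>exp (- x) x\<^sup>\<mu> F(x) \<rightarrow> K\<close> as \<open>x \<rightarrow> \<infinity>\<close>; no integral representation is needed.
  Comparing with the prescribed behaviour of \<open>Y\<^sub>1\<close>, for \<open>p\<close> along \<open>arg z = 0\<close> and for \<open>q\<close>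
  along \<open>arg z = - \<pi>\<close>, gives for each column two linear equations for the entries
  \<open>C\<^sub>1\<^sub>j\<close>, \<open>C\<^sub>3\<^sub>j\<close> with determinant a multiple of \<open>cos (\<pi> \<mu>)\<close>; Legendre's duplication formula
  turns the solution into the stated form.
\<close>

text \<open>Otherwise \<open>$\<close> is ambiguous between \<open>fps_nth\<close> and \<open>vec_nth\<close>.\<close>

no_notation fps_nth (infixl \<open>$\<close> 75)

section \<open>Poisson averages of complex powers\<close>

definition poisson_weight :: "real \<Rightarrow> nat \<Rightarrow> real" where
  "poisson_weight x n = exp (- x) * x ^ n / fact n"

section \<open>Poisson moments of both signs\<close>

lemma poisson_weight_nonneg: "x \<ge> 0 \<Longrightarrow> poisson_weight x n \<ge> 0"
  by (simp add: poisson_weight_def)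

lemma sums_exp_real: "(\<lambda>n. x ^ n / fact n) sums exp (x::real)"
  using exp_converges[of x] by (simp add: field_simps)

lemma poisson_weight_sums: "poisson_weight x sums 1"
  using sums_mult[OF sums_exp_real, of "exp (-x)" x]
  by (simp add: poisson_weight_def[abs_def] exp_minus)

lemma poisson_weight_Suc: "real (Suc n) * poisson_weight x (Suc n) = x * poisson_weight x n"
  by (simp add: poisson_weight_def divide_simps)

lemma poisson_mean: "(\<lambda>n. real n * poisson_weight x n) sums x"
proof -
  have "(\<lambda>n. real (Suc n) * poisson_weight x (Suc n)) sums x"
    using sums_mult[OF poisson_weight_sums, of x x] unfolding poisson_weight_Suc by simp
  from sums_Suc[OF this] show ?thesis by simp
qed

lemma poisson_second_factorial_moment:
  "(\<lambda>n. real n * (real n - 1) * poisson_weight x n) sums (x\<^sup>2)"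
proof -
  have "(\<lambda>n. real (Suc n) * (real (Suc n) - 1) * poisson_weight x (Suc n)) sums (x\<^sup>2)"
  proof -
    have "real (Suc n) * (real (Suc n) - 1) * poisson_weight x (Suc n) = x * (real n * poisson_weight x n)" for n
    proof -
      have "real (Suc n) * (real (Suc n) - 1) * poisson_weight x (Suc n) = real n * (real (Suc n) * poisson_weight x (Suc n))"
        by (simp add: algebra_simps)
      then show ?thesis unfolding poisson_weight_Suc by simp
    qed
    then show ?thesis using sums_mult[OF poisson_mean, of x x] by (simp only: power2_eq_square)
  qed
  from sums_Suc[OF this] show ?thesis by simp
qed

text \<open>The variance \<open>x\<close> plus the squared bias 1: the deviation is measured from
  \<open>n + 1\<close> instead of \<open>n\<close>, because the later ratios
  \<open>(n + 1) / x\<close> must not vanish.\<close>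

lemma poisson_variance:
  "(\<lambda>n. (real n + 1 - x)\<^sup>2 * poisson_weight x n) sums (x + 1)"
proof -
  have "(\<lambda>n. real n * (real n - 1) * poisson_weight x n + (3 - 2*x) * (real n * poisson_weight x n)
      + (1 - x)\<^sup>2 * poisson_weight x n) sums (x\<^sup>2 + (3 - 2*x) * x + (1 - x)\<^sup>2 * 1)"
    by (intro sums_add sums_mult poisson_second_factorial_moment poisson_mean poisson_weight_sums)
  also have "x\<^sup>2 + (3 - 2*x) * x + (1 - x)\<^sup>2 * 1 = x + 1"
    by (simp add: power2_eq_square algebra_simps)
  also have "(\<lambda>n. real n * (real n - 1) * poisson_weight x n + (3 - 2*x) * (real n * poisson_weight x n)
      + (1 - x)\<^sup>2 * poisson_weight x n) = (\<lambda>n. (real n + 1 - x)\<^sup>2 * poisson_weight x n)"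
    by (simp add: fun_eq_iff power2_eq_square algebra_simps)
  finally show ?thesis .
qed

text \<open>The bound \<open>u ^ k \<le> fact k * exp u\<close> with \<open>u = (n + 1) / x\<close>
  reduces every moment to an exponential one, which the exponential series evaluates. The resulting
  exponent \<open>1/x - x + x * exp (1/x)\<close> stays bounded for
  \<open>x \<ge> 1\<close>.\<close>

lemma poisson_positive_moment:
  assumes "x \<ge> 1"
  shows "summable (\<lambda>n. ((real n + 1) / x) ^ k * poisson_weight x n)"
    and "(\<Sum>n. ((real n + 1) / x) ^ k * poisson_weight x n) \<le> fact k * exp 3"
proof -
  define a where "a = exp (1 / x)"
  have le: "((real n + 1) / x) ^ k * poisson_weight x n
      \<le> fact k * exp (1 / x - x) * ((x * a) ^ n / fact n)" for n
  proof -
    have "((real n + 1) / x) ^ k / fact k \<le> exp ((real n + 1) / x)"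
    proof -
      \<comment> \<open>One term of the exponential series is at most the whole sum, all terms being
        nonnegative.\<close>
      have "(\<Sum>i\<in>{k}. ((real n + 1) / x) ^ i / fact i) \<le> exp ((real n + 1) / x)"
        using assms sums_exp_real[of "(real n + 1) / x"]
          sum_le_suminf[of "\<lambda>i. ((real n + 1) / x) ^ i / fact i" "{k}"]
        by (auto simp: sums_iff)
      then show ?thesis by simp
    qed
    then have "((real n + 1) / x) ^ k \<le> fact k * exp ((real n + 1) / x)"
      unfolding pos_divide_le_eq[OF fact_gt_zero] by (simp only: mult.commute)
    then have "((real n + 1) / x) ^ k * poisson_weight x n
        \<le> fact k * exp ((real n + 1) / x) * poisson_weight x n"
      using assms by (intro mult_right_mono poisson_weight_nonneg) auto
    also have "exp ((real n + 1) / x) = exp (1/x) * a ^ n"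
      by (simp add: a_def add_divide_distrib exp_add exp_of_nat_mult[symmetric])
    finally show ?thesis
      by (simp add: poisson_weight_def exp_diff exp_minus field_simps power_mult_distrib)
  qed
  have s: "(\<lambda>n. fact k * exp (1 / x - x) * ((x * a) ^ n / fact n))
      sums (fact k * exp (1 / x - x) * exp (x * a))"
    by (intro sums_mult sums_exp_real)
  show sm: "summable (\<lambda>n. ((real n + 1) / x) ^ k * poisson_weight x n)"
    using assms le poisson_weight_nonneg[of x]
    by (intro summable_comparison_test'[OF sums_summable[OF s], of 0]) auto
  have "(\<Sum>n. ((real n + 1) / x) ^ k * poisson_weight x n) \<le> fact k * exp (1 / x - x) * exp (x * a)"
    using suminf_le[OF le sm sums_summable[OF s]] s by (simp add: sums_iff)
  also have "\<dots> = fact k * exp (1 / x - x + x * a)"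
    by (simp add: exp_add)
  also have "1 / x - x + x * a \<le> 3"
  proof -
    have "a \<le> 1 + 1/x + (1/x)\<^sup>2" unfolding a_def using assms by (intro exp_bound) auto
    then have "x * a \<le> x * (1 + 1/x + (1/x)\<^sup>2)" using assms by (intro mult_left_mono) auto
    also have "\<dots> = x + 1 + 1/x" using assms by (simp add: field_simps power2_eq_square)
    finally have "1/x - x + x * a \<le> 1 + 2 * (1/x)" by simp
    moreover have "1/x \<le> 1" using assms by simp
    ultimately show ?thesis by linarith
  qed
  finally show "(\<Sum>n. ((real n + 1) / x) ^ k * poisson_weight x n) \<le> fact k * exp 3"
    by simp
qed

text \<open>Each factor \<open>n + i\<close> of \<open>fact (n + k) / fact n\<close> is at most
  \<open>i * (n + 1)\<close>.\<close>

lemma fact_add_le: "fact (n + k) \<le> (fact k * fact n * (real n + 1) ^ k :: real)"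
proof (induction k)
  case (Suc k)
  have "(fact (n + Suc k) :: real) = (real n + 1 + real k) * fact (n + k)" by simp
  also have "\<dots> \<le> (real (Suc k) * (real n + 1)) * (fact k * fact n * (real n + 1) ^ k)"
    using Suc by (intro mult_mono) (auto simp: algebra_simps)
  also have "\<dots> = fact (Suc k) * fact n * (real n + 1) ^ Suc k" by (simp add: algebra_simps)
  finally show ?case .
qed simp

text \<open>By \<open>fact_add_le\<close>, dividing by \<open>(n + 1) ^ k\<close> costs at most
  \<open>fact k\<close> when the weight is moved from \<open>n\<close> to \<open>n + k\<close>, so
  the moment is at most \<open>fact k\<close> times a tail of the distribution.\<close>

lemma poisson_negative_moment:
  assumes "x > 0"
  shows "summable (\<lambda>n. (x / (real n + 1)) ^ k * poisson_weight x n)"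
    and "(\<Sum>n. (x / (real n + 1)) ^ k * poisson_weight x n) \<le> fact k"
proof -
  have le: "(x / (real n + 1)) ^ k * poisson_weight x n \<le> fact k * poisson_weight x (n + k)" for n
  proof -
    have "inverse (fact k * fact n * (real n + 1) ^ k) \<le> inverse (fact (n + k) :: real)"
      by (intro le_imp_inverse_le fact_add_le) auto
    then have "inverse (fact n * (real n + 1) ^ k) \<le> fact k * inverse (fact (n + k) :: real)"
      by (simp add: field_simps)
    then have "(exp (-x) * x ^ (n + k)) * inverse (fact n * (real n + 1) ^ k)
        \<le> (exp (-x) * x ^ (n + k)) * (fact k * inverse (fact (n + k)))"
      using assms by (intro mult_left_mono) auto
    then show ?thesis
      by (simp add: poisson_weight_def field_simps power_add)
  qed
  have s: "(\<lambda>n. fact k * poisson_weight x (n + k))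
      sums (fact k * (1 - (\<Sum>n<k. poisson_weight x n)))"
    using sums_split_initial_segment[OF poisson_weight_sums] by (intro sums_mult)
  show sm: "summable (\<lambda>n. (x / (real n + 1)) ^ k * poisson_weight x n)"
    using assms le poisson_weight_nonneg[of x]
    by (intro summable_comparison_test'[OF sums_summable[OF s], of 0]) auto
  have "(\<Sum>n. (x / (real n + 1)) ^ k * poisson_weight x n) \<le> fact k * (1 - (\<Sum>n<k. poisson_weight x n))"
    using suminf_le[OF le sm sums_summable[OF s]] s by (simp add: sums_iff)
  also have "\<dots> \<le> fact k"
    using assms by (simp add: sum_nonneg poisson_weight_nonneg)
  finally show "(\<Sum>n. (x / (real n + 1)) ^ k * poisson_weight x n) \<le> fact k" .
qed

section \<open>Comparison of powers with 1, and limits of Poisson averages\<close>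

text \<open>Mean value inequality between 1 and \<open>y\<close>. Adding the powers of both signs
  covers \<open>y \<ge> 1\<close> and \<open>y \<le> 1\<close> at once, and the integer exponent
  makes the bound accessible to the moment estimates.\<close>

lemma norm_powr_diff_one_le:
  fixes \<mu> :: complex and y :: real
  assumes "y > 0" and k: "real k \<ge> \<bar>Re \<mu>\<bar> + 1"
  shows "norm (of_real y powr \<mu> - 1) \<le> norm \<mu> * \<bar>y - 1\<bar> * (y ^ k + (1 / y) ^ k)"
proof -
  have "norm (of_real y powr \<mu> - of_real 1 powr \<mu>) \<le> (norm \<mu> * (y ^ k + (1 / y) ^ k)) * norm (of_real y - of_real 1 :: complex)"
  \<comment> \<open>The bound is applied on the real segment from 1 to \<open>y\<close>, embedded in
    the plane; it avoids the branch cut of \<open>powr\<close>.\<close>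
  proof (rule field_differentiable_bound[where S = "of_real ` closed_segment 1 y" and f' = "\<lambda>z. \<mu> * z powr (\<mu> - 1)"])
    show "convex (of_real ` closed_segment 1 y :: complex set)"
      by (intro convex_linear_image) (auto simp: bounded_linear.linear bounded_linear_of_real)
    fix z :: complex assume "z \<in> of_real ` closed_segment 1 y"
    then obtain s where s: "z = of_real s" "s \<in> closed_segment 1 y" by auto
    have sp: "s > 0" and sr: "(1 \<le> s \<and> s \<le> y) \<or> (y \<le> s \<and> s \<le> 1)"
      using s(2) assms(1) by (auto simp: closed_segment_eq_real_ivl split: if_splits)
    show "((\<lambda>z. z powr \<mu>) has_field_derivative \<mu> * z powr (\<mu> - 1)) (at z within of_real ` closed_segment 1 y)"
      using sp s by (intro has_field_derivative_powr DERIV_subset[OF has_field_derivative_powr]) auto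
    have "norm (z powr (\<mu> - 1)) = s powr (Re \<mu> - 1)"
      using sp s by (simp add: norm_powr_real_powr)
    also have "\<dots> \<le> y ^ k + (1 / y) ^ k"
      using sr
    proof
      assume a: "1 \<le> s \<and> s \<le> y"
      have "s powr (Re \<mu> - 1) \<le> s powr real k" using a k by (intro powr_mono) auto
      also have "\<dots> = s ^ k" using sp by (simp add: powr_realpow)
      also have "\<dots> \<le> y ^ k" using a by (intro power_mono) auto
      finally show ?thesis using assms by (simp add: add_increasing2)
    next
      assume a: "y \<le> s \<and> s \<le> 1"
      have "s powr (Re \<mu> - 1) \<le> s powr (- real k)" using a k sp by (intro powr_mono') auto
      also have "\<dots> = (1 / s) ^ k" using sp by (simp add: powr_minus powr_realpow divide_inverse power_inverse)
      also have "\<dots> \<le> (1 / y) ^ k" using a sp assms by (intro power_mono) (auto simp: field_simps)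
      finally show ?thesis using assms by (simp add: add_increasing)
    qed
    finally show "norm (\<mu> * z powr (\<mu> - 1)) \<le> norm \<mu> * (y ^ k + (1 / y) ^ k)"
      by (simp add: norm_mult mult_left_mono)
  qed auto
  then show ?thesis by (simp add: mult_ac flip: norm_of_real[of "y - 1", where 'a = complex])
qed

lemma poisson_weight_tendsto_0: "((\<lambda>x. poisson_weight x n) \<longlongrightarrow> 0) at_top"
proof -
  have "((\<lambda>x::real. x ^ n / exp x) \<longlongrightarrow> 0) at_top" by (rule tendsto_power_div_exp_0)
  then have "((\<lambda>x::real. x ^ n / exp x / fact n) \<longlongrightarrow> 0 / fact n) at_top" by (intro tendsto_intros) auto
  then show ?thesis by (simp add: poisson_weight_def exp_minus divide_inverse mult_ac)
qed

lemma poisson_average_summable: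
  fixes d :: "nat \<Rightarrow> complex"
  assumes "Bseq d"
  shows "summable (\<lambda>n. norm (of_real (poisson_weight x n) * d n))"
proof -
  from assms obtain D where D: "\<And>n. norm (d n) \<le> D" unfolding Bseq_def by auto
  have "summable (\<lambda>n. norm (x ^ n / fact n))"
    using summable_norm_exp[of x] by (simp add: field_simps)
  then have "summable (\<lambda>n. exp (-x) * D * norm (x ^ n / fact n))"
    by (rule summable_mult)
  then show ?thesis
  proof (rule summable_comparison_test'[where N = 0])
    fix n
    show "norm (norm (of_real (poisson_weight x n) * d n)) \<le> exp (-x) * D * norm (x ^ n / fact n)"
      using mult_left_mono[OF D, of "exp (-x) * \<bar>x ^ n / fact n\<bar>" n]
      by (simp add: norm_mult norm_divide norm_power power_abs poisson_weight_def abs_mult mult_ac)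
  qed
qed

text \<open>Regularity of the averaging: the total mass is 1 and each single weight tends to 0, so
  finitely many initial terms disappear in the limit while the others are uniformly small.\<close>

lemma poisson_average_tendsto_0:
  fixes d :: "nat \<Rightarrow> complex"
  assumes "d \<longlonglongrightarrow> 0"
  shows "((\<lambda>x. \<Sum>n. of_real (poisson_weight x n) * d n) \<longlongrightarrow> 0) at_top"
proof (rule tendstoI)
  fix e :: real assume e: "e > 0"
  from assms e obtain N where N: "\<And>n. n \<ge> N \<Longrightarrow> norm (d n) < e / 2"
    by (metis LIMSEQ_iff half_gt_zero diff_zero)
  have B: "Bseq d" using assms convergent_imp_Bseq convergentI by blast
  have "((\<lambda>x. \<Sum>n<N. poisson_weight x n * norm (d n)) \<longlongrightarrow> (\<Sum>n<N. 0 * norm (d n))) at_top"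
    by (intro tendsto_intros poisson_weight_tendsto_0)
  then have "eventually (\<lambda>x. (\<Sum>n<N. poisson_weight x n * norm (d n)) < e / 2) at_top"
    using e by (intro order_tendstoD) auto
  with eventually_gt_at_top[of 0]
  show "eventually (\<lambda>x. dist (\<Sum>n. of_real (poisson_weight x n) * d n) 0 < e) at_top"
  proof eventually_elim
    case (elim x)
    have s: "summable (\<lambda>n. norm (of_real (poisson_weight x n) * d n))"
      by (rule poisson_average_summable[OF B])
    have s1: "(\<lambda>n. e / 2 * poisson_weight x n + (if n \<in> {..<N} then poisson_weight x n * norm (d n) else 0))
       sums (e / 2 * 1 + (\<Sum>n<N. poisson_weight x n * norm (d n)))"
      by (intro sums_add sums_mult poisson_weight_sums sums_If_finite_set) auto
    have "norm (\<Sum>n. of_real (poisson_weight x n) * d n) \<le> (\<Sum>n. norm (of_real (poisson_weight x n) * d n))"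
      by (rule summable_norm[OF s])
    also have "\<dots> \<le> e / 2 * 1 + (\<Sum>n<N. poisson_weight x n * norm (d n))"
    proof -
      have "norm (of_real (poisson_weight x n) * d n) \<le> e / 2 * poisson_weight x n + (if n \<in> {..<N} then poisson_weight x n * norm (d n) else 0)" for n
        using poisson_weight_nonneg[of x n] elim e mult_right_mono[OF less_imp_le[OF N[of n]], of "poisson_weight x n"]
        by (auto simp: norm_mult mult_ac)
      from suminf_le[OF this s sums_summable[OF s1]] s1 show ?thesis by (simp add: sums_iff)
    qed
    finally show ?case using elim by simp
  qed
qed

text \<open>Weighted inequality of arithmetic and geometric means; the free parameter
  \<open>h\<close> will balance the variance against the moments.\<close>

lemma abs_times_le:
  fixes a b h :: real
  assumes "h > 0"
  shows "a * b \<le> h * b\<^sup>2 / 2 + a\<^sup>2 / (2 * h)"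
proof -
  have "0 \<le> (h * b - a)\<^sup>2" by simp
  then have "2 * h * (a * b) \<le> h\<^sup>2 * b\<^sup>2 + a\<^sup>2" by (simp add: power2_eq_square algebra_simps)
  then show ?thesis using assms by (simp add: field_simps power2_eq_square)
qed

text \<open>Since the Poisson variable \<open>N\<close> of mean \<open>x\<close> has variance \<open>x\<close>, the ratio \<open>(N + 1) / x\<close>
  concentrates at \<open>1\<close>; the moments of both signs turn this into convergence of complex powers.\<close>

lemma poisson_powr_deviation:
  fixes \<mu> :: complex
  shows "\<exists>K. \<forall>x\<ge>1. summable (\<lambda>n. poisson_weight x n * norm (of_real ((real n + 1) / x) powr \<mu> - 1))
     \<and> (\<Sum>n. poisson_weight x n * norm (of_real ((real n + 1) / x) powr \<mu> - 1)) \<le> K / sqrt x"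
proof -
  define k where "k = nat \<lceil>\<bar>Re \<mu>\<bar> + 1\<rceil>"
  have k: "real k \<ge> \<bar>Re \<mu>\<bar> + 1" unfolding k_def by linarith
  define M :: real where "M = fact (2*k) * exp 3 + fact (2*k)"
  define K where "K = norm \<mu> * (M + 1)"
  show ?thesis
  proof (intro exI[of _ K] allI impI)
    fix x :: real assume x: "x \<ge> 1"
    \<comment> \<open>This choice gives all three contributions the order \<open>1 / sqrt x\<close>:
      the moments of order \<open>2*k\<close> are bounded, and the variance \<open>x + 1\<close>
      enters as \<open>(x + 1) / (2 * h * x\<^sup>2) \<le> h\<close>.\<close>
    define h where "h = 1 / sqrt x"
    have h: "h > 0" using x by (simp add: h_def)
    define y where "y n = (real n + 1) / x" for n
    have y: "y n > 0" for n using x by (simp add: y_def add_pos_nonneg)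
    let ?b = "\<lambda>n. norm \<mu> * (h * (y n ^ (2*k) * poisson_weight x n)
        + h * ((x / (real n + 1)) ^ (2*k) * poisson_weight x n)
        + 1 / (2 * h * x\<^sup>2) * ((real n + 1 - x)\<^sup>2 * poisson_weight x n))"
    have le: "poisson_weight x n * norm (of_real (y n) powr \<mu> - 1) \<le> ?b n" for n
    proof -
      have "norm (of_real (y n) powr \<mu> - 1) \<le> norm \<mu> * (\<bar>y n - 1\<bar> * (y n ^ k + (1 / y n) ^ k))"
        using norm_powr_diff_one_le[OF y k] by (simp add: mult.assoc)
      also have "\<bar>y n - 1\<bar> * (y n ^ k + (1 / y n) ^ k)
          \<le> h * (y n ^ k + (1 / y n) ^ k)\<^sup>2 / 2 + \<bar>y n - 1\<bar>\<^sup>2 / (2 * h)"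
        by (rule abs_times_le[OF h])
      also have "\<dots> \<le> h * (y n ^ (2*k) + (1 / y n) ^ (2*k)) + (y n - 1)\<^sup>2 / (2 * h)"
      proof -
        have "(p + q)\<^sup>2 / 2 \<le> p\<^sup>2 + q\<^sup>2" for p q :: real
          using sum_squares_bound[of p q] by (simp add: power2_sum)
        from this[of "y n ^ k" "(1 / y n) ^ k"]
        have "(y n ^ k + (1 / y n) ^ k)\<^sup>2 / 2 \<le> y n ^ (2*k) + (1 / y n) ^ (2*k)"
          by (simp only: power_mult[symmetric] mult.commute)
        from mult_left_mono[OF this, of h] h show ?thesis by simp
      qed
      finally have "norm (of_real (y n) powr \<mu> - 1) \<le> norm \<mu> * (h * (y n ^ (2*k) + (1 / y n) ^ (2*k)) + (y n - 1)\<^sup>2 / (2 * h))"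
        by (simp add: mult_left_mono)
      then have "poisson_weight x n * norm (of_real (y n) powr \<mu> - 1) \<le> poisson_weight x n *
         (norm \<mu> * (h * (y n ^ (2*k) + (1 / y n) ^ (2*k)) + (y n - 1)\<^sup>2 / (2 * h)))"
        using x by (intro mult_left_mono poisson_weight_nonneg) auto
      also have "1 / y n = x / (real n + 1)" by (simp add: y_def)
      also have "(y n - 1)\<^sup>2 / (2 * h) = 1 / (2 * h * x\<^sup>2) * (real n + 1 - x)\<^sup>2"
        using x by (simp add: y_def power2_eq_square field_simps)
      finally show ?thesis by (simp add: algebra_simps)
    qed
    note pm = poisson_positive_moment[OF x, of "2*k", folded y_def]
    have x0: "x > 0" using x by simp
    note nm = poisson_negative_moment[OF x0, of "2*k"]
    have bs: "?b sums (norm \<mu> * (h * (\<Sum>n. y n ^ (2*k) * poisson_weight x n)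
        + h * (\<Sum>n. (x / (real n + 1)) ^ (2*k) * poisson_weight x n) + 1 / (2 * h * x\<^sup>2) * (x + 1)))" (is "_ sums ?B")
      by (intro sums_mult sums_add summable_sums pm nm poisson_variance)
    have "?B \<le> norm \<mu> * (h * (fact (2*k) * exp 3) + h * fact (2*k) + h)"
    proof -
      have "1 / (2 * h * x\<^sup>2) * (x + 1) \<le> h"
      proof -
        have "h * h = 1 / x" using x by (simp add: h_def)
        then have "h * (2 * h * x\<^sup>2) = 2 * x" using x by (simp add: power2_eq_square field_simps)
        then show ?thesis using x h by (simp add: field_simps)
      qed
      then show ?thesis using pm nm h by (intro mult_left_mono add_mono) auto
    qed
    also have "\<dots> = K / sqrt x" by (simp add: K_def M_def h_def add_divide_distrib algebra_simps)
    finally have BK: "?B \<le> K / sqrt x" .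
    have sm: "summable (\<lambda>n. poisson_weight x n * norm (of_real (y n) powr \<mu> - 1))"
      using le poisson_weight_nonneg[of x] x
      by (intro summable_comparison_test'[OF sums_summable[OF bs], of 0]) auto
    have "(\<Sum>n. poisson_weight x n * norm (of_real (y n) powr \<mu> - 1)) \<le> ?B"
      using suminf_le[OF le sm sums_summable[OF bs]] sums_unique[OF bs] by argo
    with BK sm show "summable (\<lambda>n. poisson_weight x n * norm (of_real ((real n + 1) / x) powr \<mu> - 1))
     \<and> (\<Sum>n. poisson_weight x n * norm (of_real ((real n + 1) / x) powr \<mu> - 1)) \<le> K / sqrt x"
      unfolding y_def by linarith
  qed
qed

text \<open>With \<open>d n = c n * (n + 1)\<close> to the power \<open>\<mu>\<close>, the
  expression is the Poisson average of \<open>d n\<close> times \<open>(n + 1) / x\<close> to the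
  power \<open>- \<mu>\<close>. The first factor tends to \<open>L\<close>, and the second
  concentrates at 1.\<close>

lemma exp_powr_series_tendsto:
  fixes c :: "nat \<Rightarrow> complex" and \<mu> L :: complex
  assumes "(\<lambda>n. c n * of_nat (Suc n) powr \<mu>) \<longlonglongrightarrow> L"
  shows "((\<lambda>x::real. exp (- of_real x) * of_real x powr \<mu> * (\<Sum>n. c n * of_real x ^ n / fact n)) \<longlongrightarrow> L) at_top"
proof -
  define d where "d n = c n * of_nat (Suc n) powr \<mu>" for n
  have dL: "d \<longlonglongrightarrow> L" using assms by (simp add: d_def[abs_def])
  then have "Bseq d" using convergent_imp_Bseq convergentI by blast
  then obtain D where D: "D > 0" "\<And>n. norm (d n) \<le> D" unfolding Bseq_def by auto
  obtain K where K: "\<And>x. x \<ge> 1 \<Longrightarrow> summable (\<lambda>n. poisson_weight x n * norm (of_real ((real n + 1) / x) powr - \<mu> - 1))"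
     "\<And>x. x \<ge> 1 \<Longrightarrow> (\<Sum>n. poisson_weight x n * norm (of_real ((real n + 1) / x) powr - \<mu> - 1)) \<le> K / sqrt x"
    using poisson_powr_deviation[of "-\<mu>"] by blast
  \<comment> \<open>Writing \<open>u\<close> for the power of \<open>(n + 1) / x\<close>, the
    splitting \<open>d * u = d * (u - 1) + (d - L) + L\<close> is used: \<open>R\<close> sums the
    first part and \<open>S\<close> the second, while the third averages to
    \<open>L\<close>.\<close>
  define S where "S x = (\<Sum>n. of_real (poisson_weight x n) * (d n - L))" for x
  define R where "R x = (\<Sum>n. of_real (poisson_weight x n) * d n * (of_real ((real n + 1) / x) powr - \<mu> - 1))" for x
  have dL0: "(\<lambda>n. d n - L) \<longlonglongrightarrow> 0" using dL by (simp add: LIM_zero)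
  have S: "(S \<longlongrightarrow> 0) at_top" unfolding S_def[abs_def]
    by (rule poisson_average_tendsto_0[OF dL0])
  have Rs: "summable (\<lambda>n. norm (of_real (poisson_weight x n) * d n * (of_real ((real n + 1) / x) powr - \<mu> - 1)))"
    and Rle: "norm (R x) \<le> D * (K / sqrt x)" if x: "x \<ge> 1" for x
  proof -
    have le: "norm (of_real (poisson_weight x n) * d n * (of_real ((real n + 1) / x) powr - \<mu> - 1))
       \<le> D * (poisson_weight x n * norm (of_real ((real n + 1) / x) powr - \<mu> - 1))" for n
      using mult_right_mono[OF D(2)[of n], of "poisson_weight x n * norm (of_real ((real n + 1) / x) powr - \<mu> - 1)"]
        poisson_weight_nonneg[of x n] x by (simp add: norm_mult mult_ac)
    show s: "summable (\<lambda>n. norm (of_real (poisson_weight x n) * d n * (of_real ((real n + 1) / x) powr - \<mu> - 1)))"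
      using le by (intro summable_comparison_test'[OF summable_mult[OF K(1)[OF x], of D], of 0]) auto
    have "norm (R x) \<le> (\<Sum>n. norm (of_real (poisson_weight x n) * d n * (of_real ((real n + 1) / x) powr - \<mu> - 1)))"
      unfolding R_def by (rule summable_norm[OF s])
    also have "\<dots> \<le> (\<Sum>n. D * (poisson_weight x n * norm (of_real ((real n + 1) / x) powr - \<mu> - 1)))"
      by (rule suminf_le[OF le s summable_mult[OF K(1)[OF x]]])
    also have "\<dots> = D * (\<Sum>n. poisson_weight x n * norm (of_real ((real n + 1) / x) powr - \<mu> - 1))"
      by (rule suminf_mult[OF K(1)[OF x]])
    also have "\<dots> \<le> D * (K / sqrt x)" using D K(2)[OF x] by (intro mult_left_mono) auto
    finally show "norm (R x) \<le> D * (K / sqrt x)" .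
  qed
  have R: "(R \<longlongrightarrow> 0) at_top"
  proof (rule Lim_null_comparison)
    show "eventually (\<lambda>x. norm (R x) \<le> D * (K / sqrt x)) at_top"
      using eventually_ge_at_top[of 1] by eventually_elim (rule Rle)
    have "filterlim sqrt at_top at_top" by (rule sqrt_at_top)
    then have "((\<lambda>x. D * (K / sqrt x)) \<longlongrightarrow> D * 0) at_top"
      by (intro tendsto_mult tendsto_const real_tendsto_divide_at_top[OF tendsto_const])
    then show "((\<lambda>x. D * (K / sqrt x)) \<longlongrightarrow> 0) at_top" by simp
  qed
  have "((\<lambda>x. R x + S x + L) \<longlongrightarrow> 0 + 0 + L) at_top" by (intro tendsto_intros R S)
  moreover have "eventually (\<lambda>x::real. R x + S x + L = exp (- of_real x) * of_real x powr \<mu> * (\<Sum>n. c n * of_real x ^ n / fact n)) at_top"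
    using eventually_ge_at_top[of 1]
  proof eventually_elim
    case (elim x)
    let ?w = "\<lambda>n. of_real (poisson_weight x n) :: complex"
    have B: "Bseq (\<lambda>n. d n - L)" using dL0 convergent_imp_Bseq convergentI by blast
    have wL: "(\<lambda>n. ?w n * L) sums (of_real 1 * L)"
      by (intro sums_mult2 sums_of_real poisson_weight_sums)
    have Ss: "(\<lambda>n. ?w n * (d n - L)) sums S x"
      unfolding S_def using summable_norm_cancel[OF poisson_average_summable[OF B]] by (rule summable_sums)
    have Rss: "(\<lambda>n. ?w n * d n * (of_real ((real n + 1) / x) powr - \<mu> - 1)) sums R x"
      unfolding R_def using summable_norm_cancel[OF Rs[OF elim]] by (rule summable_sums)
    have tot: "(\<lambda>n. ?w n * d n * (of_real ((real n + 1) / x) powr - \<mu> - 1) + ?w n * (d n - L) + ?w n * L)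
        sums (R x + S x + of_real 1 * L)"
      by (intro sums_add wL Ss Rss)
    have x0: "x > 0" using elim by simp
    let ?m = "exp (- of_real x) * of_real x powr \<mu> :: complex"
    have m0: "?m \<noteq> 0" using x0 by simp
    have trm: "?w n * d n * (of_real ((real n + 1) / x) powr - \<mu> - 1) + ?w n * (d n - L) + ?w n * L
        = ?m * (c n * of_real x ^ n / fact n)" for n
    proof -
      \<comment> \<open>All bases are positive reals, so the quotient rule for powers holds with no
        branch correction.\<close>
      have "of_real ((real n + 1) / x) powr - \<mu> = (of_real (real (Suc n)) powr - \<mu> / of_real x powr - \<mu> :: complex)"
        using x0 by (simp add: powr_def Ln_of_real ln_div exp_diff[symmetric] ring_distribs add.commute
            del: of_real_divide of_real_add of_real_of_nat_eq)
      then have *: "of_nat (Suc n) powr \<mu> * of_real ((real n + 1) / x) powr - \<mu> = (of_real x powr \<mu> :: complex)"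
        using x0 by (simp add: powr_minus field_simps del: of_nat_Suc)
      have "?w n * d n * (of_real ((real n + 1) / x) powr - \<mu> - 1) + ?w n * (d n - L) + ?w n * L
        = ?w n * c n * (of_nat (Suc n) powr \<mu> * of_real ((real n + 1) / x) powr - \<mu>)"
        by (simp add: d_def algebra_simps)
      also have "\<dots> = ?w n * c n * of_real x powr \<mu>" by (simp only: *)
      finally show ?thesis by (simp add: poisson_weight_def exp_of_real[symmetric] of_real_exp)
    qed
    have "(\<lambda>n. c n * of_real x ^ n / fact n) sums ((R x + S x + of_real 1 * L) / ?m)"
      using sums_divide[OF tot, of ?m] m0 unfolding trm by simp
    then have "(\<Sum>n. c n * of_real x ^ n / fact n) = (R x + S x + L) / ?m" by (simp add: sums_iff)
    then show ?case using m0 by simp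
  qed
  ultimately show ?thesis using tendsto_cong by force
qed

section \<open>Growth of quotients of Pochhammer symbols\<close>

text \<open>Quotient of the Euler-Gauss product formulas for \<open>a\<close> and \<open>b\<close>.
  If \<open>a\<close> is a pole of Gamma, then \<open>Gamma a = 0\<close> by convention and the
  claimed limit is 0, in agreement with \<open>rGamma a = 0\<close>.\<close>

lemma pochhammer_ratio_tendsto:
  fixes a b :: complex
  assumes "b \<notin> \<int>\<^sub>\<le>\<^sub>0"
  shows "(\<lambda>n. pochhammer a n / pochhammer b n * of_nat (Suc n) powr (b - a)) \<longlonglongrightarrow> Gamma b / Gamma a"
proof -
  have "(\<lambda>n. rGamma_series a n * Gamma_series b n) \<longlonglongrightarrow> rGamma a * Gamma b"
    using assms by (intro tendsto_intros)
  \<comment> \<open>The products at \<open>n\<close> contain \<open>n + 1\<close> factors but the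
    power of \<open>n\<close>. At index \<open>Suc n\<close> the claim has the base
    \<open>n + 2\<close>, so this correction factor with limit 1 is inserted.\<close>
  moreover have "(\<lambda>n. exp ((b - a) * of_real (ln ((real n + 2) / real n)))) \<longlonglongrightarrow> exp ((b - a) * of_real (ln 1))"
  proof -
    have "(\<lambda>n. 1 + 2 / real n) \<longlonglongrightarrow> 1 + 0"
      by (intro tendsto_add tendsto_const lim_const_over_n)
    moreover have "eventually (\<lambda>n. 1 + 2 / real n = (real n + 2) / real n) sequentially"
      using eventually_gt_at_top[of 0] by eventually_elim (simp add: field_simps)
    ultimately have "(\<lambda>n. (real n + 2) / real n) \<longlonglongrightarrow> 1"
      using tendsto_cong by force
    then show ?thesis by (intro tendsto_intros) auto
  qed
  ultimately have "(\<lambda>n. rGamma_series a n * Gamma_series b n * exp ((b - a) * of_real (ln ((real n + 2) / real n))))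
      \<longlonglongrightarrow> rGamma a * Gamma b * exp ((b - a) * of_real (ln 1))"
    by (rule tendsto_mult)
  also have "rGamma a * Gamma b * exp ((b - a) * of_real (ln 1)) = Gamma b / Gamma a"
    by (simp add: rGamma_inverse_Gamma divide_inverse mult.commute)
  finally have lim: "(\<lambda>n. rGamma_series a n * Gamma_series b n * exp ((b - a) * of_real (ln ((real n + 2) / real n))))
      \<longlonglongrightarrow> Gamma b / Gamma a" .
  have "(\<lambda>n. pochhammer a (Suc n) / pochhammer b (Suc n) * of_nat (Suc (Suc n)) powr (b - a)) \<longlonglongrightarrow> Gamma b / Gamma a"
  proof (rule Lim_transform_eventually[OF lim])
    show "eventually (\<lambda>n. rGamma_series a n * Gamma_series b n * exp ((b - a) * of_real (ln ((real n + 2) / real n)))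
      = pochhammer a (Suc n) / pochhammer b (Suc n) * of_nat (Suc (Suc n)) powr (b - a)) sequentially"
      using eventually_gt_at_top[of 0]
    proof eventually_elim
      case (elim n)
      have ln: "ln ((real n + 2) / real n) = ln (real (Suc (Suc n))) - ln (real n)"
        using elim by (simp add: ln_div add.commute)
      have "of_nat (Suc (Suc n)) powr (b - a) = exp ((b - a) * of_real (ln (real (Suc (Suc n)))))"
        by (simp add: powr_def Ln_of_nat del: of_nat_Suc)
      then show ?case unfolding ln
        by (simp add: rGamma_series_def Gamma_series_def exp_add exp_diff exp_minus ring_distribs divide_simps
             del: of_nat_Suc)
    qed
  qed
  then show ?thesis by (rule LIMSEQ_imp_Suc)
qed

section \<open>The Frobenius solutions at the origin\<close>

text \<open>Identity theorem on the covering, where a punctured disc around \<open>z = 0\<close>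
  becomes a half plane. It carries local power series identities to all of the covering.\<close>

lemma entire_eq_if_eq_on_left_half_plane:
  fixes f g :: "complex \<Rightarrow> complex"
  assumes "f holomorphic_on UNIV" "g holomorphic_on UNIV" "\<delta> > 0"
    and eq: "\<And>\<zeta>. norm (exp \<zeta>) < \<delta> \<Longrightarrow> f \<zeta> = g \<zeta>"
  shows "f \<zeta> = g \<zeta>"
proof (rule analytic_continuation_open[of "{\<zeta>. norm (exp \<zeta>) < \<delta>}" UNIV f g])
  show "open {\<zeta>::complex. norm (exp \<zeta>) < \<delta>}"
    by (intro open_Collect_less continuous_intros)
  have "norm (exp (of_real (ln (\<delta> / 2)) :: complex)) < \<delta>" using assms by simp
  then show "{\<zeta>::complex. norm (exp \<zeta>) < \<delta>} \<noteq> {}" by blast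
qed (use assms in auto)

text \<open>Comparison of coefficients after substituting \<open>z\<close> to the power
  \<open>\<nu>\<close> times a power series. The exponent \<open>\<nu>\<close> is kept apart from
  \<open>\<mu>\<close> so that the exponent 0 of the second column is included.\<close>

lemma frobenius_recursion:
  fixes p q P Q :: "complex \<Rightarrow> complex" and \<mu> \<nu> :: complex
  assumes dp: "\<And>\<zeta>. (p has_field_derivative exp \<zeta> * p \<zeta> + \<mu> * q \<zeta>) (at \<zeta>)"
    and dq: "\<And>\<zeta>. (q has_field_derivative \<mu> * p \<zeta>) (at \<zeta>)"
    and r: "r > 0" and P: "P holomorphic_on ball 0 r" and Q: "Q holomorphic_on ball 0 r"
    and pP: "\<And>\<zeta>. norm (exp \<zeta>) < r \<Longrightarrow> p \<zeta> = exp (\<nu> * \<zeta>) * P (exp \<zeta>)"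
    and qQ: "\<And>\<zeta>. norm (exp \<zeta>) < r \<Longrightarrow> q \<zeta> = exp (\<nu> * \<zeta>) * Q (exp \<zeta>)"
  obtains A B where "P has_fps_expansion A" "Q has_fps_expansion B"
    "\<And>k. (of_nat k + \<nu>) * fps_nth A k = (if k = 0 then 0 else fps_nth A (k - 1)) + \<mu> * fps_nth B k"
    "\<And>k. (of_nat k + \<nu>) * fps_nth B k = \<mu> * fps_nth A k"
proof -
  \<comment> \<open>In the coordinate \<open>\<zeta>\<close> differentiation is the Euler operator
    \<open>z d/dz\<close>, which acts on the prefactor by adding \<open>\<nu>\<close>.\<close>
  have euler: "exp (\<nu> * \<zeta>) * (exp \<zeta> * deriv R (exp \<zeta>) + \<nu> * R (exp \<zeta>)) = D"
    if R: "R holomorphic_on ball 0 r" and w: "\<And>\<xi>. norm (exp \<xi>) < r \<Longrightarrow> w \<xi> = exp (\<nu> * \<xi>) * R (exp \<xi>)"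
      and dw: "(w has_field_derivative D) (at \<zeta>)" and \<zeta>: "norm (exp \<zeta>) < r" for R w D \<zeta>
  proof -
    have "(R has_field_derivative deriv R (exp \<zeta>)) (at (exp \<zeta>))"
      using R \<zeta> by (intro holomorphic_derivI[of _ "ball 0 r"]) auto
    then have "((\<lambda>\<xi>. R (exp \<xi>)) has_field_derivative deriv R (exp \<zeta>) * exp \<zeta>) (at \<zeta>)"
      by (rule DERIV_chain2) (auto intro!: derivative_eq_intros)
    then have "((\<lambda>\<xi>. exp (\<nu> * \<xi>) * R (exp \<xi>)) has_field_derivative
        exp (\<nu> * \<zeta>) * (exp \<zeta> * deriv R (exp \<zeta>) + \<nu> * R (exp \<zeta>))) (at \<zeta>)"
      by (auto intro!: derivative_eq_intros simp: algebra_simps)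
    then have "(w has_field_derivative exp (\<nu> * \<zeta>) * (exp \<zeta> * deriv R (exp \<zeta>) + \<nu> * R (exp \<zeta>))) (at \<zeta>)"
    proof (rule has_field_derivative_transform_within_open[where S = "{\<xi>. norm (exp \<xi>) < r}"])
      show "open {\<xi>::complex. norm (exp \<xi>) < r}"
        by (intro open_Collect_less continuous_intros)
    qed (use w \<zeta> in auto)
    with dw show ?thesis by (metis DERIV_unique)
  qed
  define A where "A = fps_expansion P 0"
  define B where "B = fps_expansion Q 0"
  have A: "P has_fps_expansion A" and B: "Q has_fps_expansion B"
    using P Q r unfolding A_def B_def by (auto intro!: has_fps_expansion_fps_expansion[of "ball 0 r"])
  have ode: "z * deriv P z + \<nu> * P z - (z * P z + \<mu> * Q z) = 0"
            "z * deriv Q z + \<nu> * Q z - \<mu> * P z = 0" if z: "z \<noteq> 0" "norm z < r" for z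
  proof -
    \<comment> \<open>\<open>Ln z\<close> serves as one point of the covering over \<open>z\<close>;
      the nonvanishing prefactor then cancels.\<close>
    have "exp (\<nu> * Ln z) * (z * deriv P z + \<nu> * P z) = exp (\<nu> * Ln z) * (z * P z + \<mu> * Q z)"
      using euler[OF P pP dp, of "Ln z"] pP[of "Ln z"] qQ[of "Ln z"] z by (simp add: algebra_simps)
    then show "z * deriv P z + \<nu> * P z - (z * P z + \<mu> * Q z) = 0" by simp
    have "exp (\<nu> * Ln z) * (z * deriv Q z + \<nu> * Q z) = exp (\<nu> * Ln z) * (\<mu> * P z)"
      using euler[OF Q qQ dq, of "Ln z"] pP[of "Ln z"] z by (simp add: algebra_simps)
    then show "z * deriv Q z + \<nu> * Q z - \<mu> * P z = 0" by simp
  qed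
  have ev: "eventually (\<lambda>z::complex. z \<in> ball 0 r) (nhds 0)"
    using r by (intro eventually_nhds_in_open) auto
  \<comment> \<open>No point of the covering lies over \<open>z = 0\<close>, so the equations are
    known only off 0. Multiplication by \<open>z\<close> makes them hold on a full neighbourhood,
    and \<open>fps_X\<close> is cancelled afterwards.\<close>
  have zero: "F = 0" if "(\<lambda>z. z * h z) has_fps_expansion fps_X * F"
      and "\<And>z. z \<noteq> 0 \<Longrightarrow> norm z < r \<Longrightarrow> h z = 0" for h :: "complex \<Rightarrow> complex" and F
  proof -
    have "eventually (\<lambda>z. z * h z = 0) (nhds 0)"
      using ev by eventually_elim (use that(2) in auto)
    then have "(\<lambda>z. z * h z) has_fps_expansion 0" by (simp add: has_fps_expansion_0_iff)
    with that(1) have "fps_X * F = 0" by (rule fps_expansion_unique_complex)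
    then show ?thesis by simp
  qed
  have 1: "fps_X * fps_deriv A + fps_const \<nu> * A - (fps_X * A + fps_const \<mu> * B) = 0"
    using ode by (intro zero[where h = "\<lambda>z. z * deriv P z + \<nu> * P z - (z * P z + \<mu> * Q z)"] fps_expansion_intros A B) auto
  have 2: "fps_X * fps_deriv B + fps_const \<nu> * B - fps_const \<mu> * A = 0"
    using ode by (intro zero[where h = "\<lambda>z. z * deriv Q z + \<nu> * Q z - \<mu> * P z"] fps_expansion_intros A B) auto
  show thesis
  proof (rule that[OF A B])
    fix k
    show "(of_nat k + \<nu>) * fps_nth A k = (if k = 0 then 0 else fps_nth A (k - 1)) + \<mu> * fps_nth B k"
      using arg_cong[OF 1, of "\<lambda>F. fps_nth F k"] by (cases k) (auto simp: algebra_simps)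
    show "(of_nat k + \<nu>) * fps_nth B k = \<mu> * fps_nth A k"
      using arg_cong[OF 2, of "\<lambda>F. fps_nth F k"] by (cases k) (auto simp: algebra_simps)
  qed
qed

section \<open>Kummer's series\<close>

definition kummer_fps :: "complex \<Rightarrow> complex fps" where
  "kummer_fps \<mu> = Abs_fps (\<lambda>n. pochhammer (1 + \<mu>) n / (pochhammer (1 + 2 * \<mu>) n * fact n))"

lemma of_nat_plus_ne_0:
  assumes "2 * \<mu> \<notin> \<int>"
  shows "of_nat n + \<mu> \<noteq> (0::complex)" "of_nat n + 2 * \<mu> \<noteq> 0"
proof -
  show *: "of_nat n + 2 * \<mu> \<noteq> 0"
  proof
    assume "of_nat n + 2 * \<mu> = 0"
    then have "2 * \<mu> = - of_nat n" by (simp add: eq_neg_iff_add_eq_0 add.commute)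
    with assms show False by simp
  qed
  show "of_nat n + \<mu> \<noteq> 0"
  proof
    assume "of_nat n + \<mu> = 0"
    then have "\<mu> = - of_nat n" by (simp add: eq_neg_iff_add_eq_0 add.commute)
    with assms show False by simp
  qed
qed

lemma kummer_fps_nth_Suc:
  assumes "2 * \<mu> \<notin> \<int>"
  shows "of_nat (Suc n) * (of_nat (Suc n) + 2 * \<mu>) * fps_nth (kummer_fps \<mu>) (Suc n)
    = (of_nat (Suc n) + \<mu>) * fps_nth (kummer_fps \<mu>) n"
proof -
  have d: "of_nat (Suc n) + 2 * \<mu> \<noteq> 0"
    by (rule of_nat_plus_ne_0(2)[OF assms])
  have cancel: "k * d * ((e * A) / (d * B * (k * F))) = e * (A / (B * F))"
    if "k \<noteq> 0" "d \<noteq> 0" for k d e A B F :: complex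
    using that by simp
  have "fps_nth (kummer_fps \<mu>) (Suc n) =
      ((of_nat (Suc n) + \<mu>) * pochhammer (1 + \<mu>) n)
      / ((of_nat (Suc n) + 2 * \<mu>) * pochhammer (1 + 2 * \<mu>) n * (of_nat (Suc n) * fact n))"
    by (simp add: kummer_fps_def pochhammer_rec' add_ac)
  then show ?thesis
    using cancel[OF _ d, of "of_nat (Suc n)"] by (simp add: kummer_fps_def del: of_nat_Suc)
qed

text \<open>Ratio test: consecutive coefficients have quotient
  \<open>(n + 1) * (1 + \<mu> / (n + 1 + \<mu>))\<close>, which is unbounded. The condition on
  \<open>\<mu>\<close> keeps every coefficient nonzero.\<close>

lemma fps_conv_radius_kummer_fps:
  assumes "2 * \<mu> \<notin> \<int>"
  shows "fps_conv_radius (kummer_fps \<mu>) = \<infinity>"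
proof -
  let ?f = "fps_nth (kummer_fps \<mu>)"
  have nz: "?f n \<noteq> 0" for n
  proof (induction n)
    case (Suc n)
    then show ?case
      using kummer_fps_nth_Suc[OF assms, of n] of_nat_plus_ne_0[OF assms, of "Suc n"]
      by (metis mult_eq_0_iff)
  qed (simp add: kummer_fps_def)
  have ratio: "?f n / ?f (Suc n) = of_nat (Suc n) * (1 + \<mu> / (of_nat (Suc n) + \<mu>))" for n
  proof -
    have "?f n / ?f (Suc n) * (of_nat (Suc n) + \<mu>) = of_nat (Suc n) * (of_nat (Suc n) + 2 * \<mu>)"
      using kummer_fps_nth_Suc[OF assms, of n] nz[of "Suc n"] by (simp add: field_simps)
    then show ?thesis using of_nat_plus_ne_0(1)[OF assms, of "Suc n"]
      by (simp add: field_simps)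
  qed
  have "filterlim (\<lambda>n. of_nat (Suc n) + \<mu> :: complex) at_infinity sequentially"
    using tendsto_add_filterlim_at_infinity[OF tendsto_const[of \<mu>] filterlim_compose[OF tendsto_of_nat filterlim_Suc]]
    by (simp add: add.commute)
  then have "(\<lambda>n. \<mu> / (of_nat (Suc n) + \<mu>)) \<longlonglongrightarrow> 0"
    by (intro tendsto_divide_0[OF tendsto_const])
  then have "(\<lambda>n. 1 + \<mu> / (of_nat (Suc n) + \<mu>)) \<longlonglongrightarrow> 1 + 0"
    by (intro tendsto_add tendsto_const)
  then have "filterlim (\<lambda>n. (1 + \<mu> / (of_nat (Suc n) + \<mu>)) * of_nat (Suc n)) at_infinity sequentially"
    by (intro tendsto_mult_filterlim_at_infinity[where c = 1] filterlim_compose[OF tendsto_of_nat filterlim_Suc]) auto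
  then have "filterlim (\<lambda>n. ?f n / ?f (Suc n)) at_infinity sequentially"
    unfolding ratio by (simp only: mult.commute)
  then have "filterlim (\<lambda>n. norm (?f n) / norm (?f (Suc n))) at_top sequentially"
    by (simp add: filterlim_at_infinity_conv_norm_at_top norm_divide)
  then have "(\<lambda>n. ereal (norm (?f n) / norm (?f (Suc n)))) \<longlonglongrightarrow> \<infinity>"
    by (simp add: tendsto_PInfty_eq_at_top)
  then have "conv_radius ?f = \<infinity>"
    using nz by (intro conv_radius_ratio_limit_ereal) auto
  then show ?thesis by (simp add: fps_conv_radius_def)
qed

section \<open>Solutions with exponents \<open>\<mu>\<close> and 0\<close>

text \<open>Eliminating the coefficients of \<open>Q\<close> from the recursion gives
  \<open>k * (k + 2 * \<mu>) * A k = (k + \<mu>) * A (k - 1)\<close>, which is Kummer's recursion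
  and determines \<open>A\<close> from \<open>A 0 = 1\<close> because \<open>2 * \<mu>\<close> is
  not an integer.\<close>

lemma frobenius_solution:
  fixes p q P Q :: "complex \<Rightarrow> complex" and \<mu> :: complex
  assumes \<mu>: "2 * \<mu> \<notin> \<int>"
    and dp: "\<And>\<zeta>. (p has_field_derivative exp \<zeta> * p \<zeta> + \<mu> * q \<zeta>) (at \<zeta>)"
    and dq: "\<And>\<zeta>. (q has_field_derivative \<mu> * p \<zeta>) (at \<zeta>)"
    and r: "r > 0" and P: "P holomorphic_on ball 0 r" and Q: "Q holomorphic_on ball 0 r"
    and pP: "\<And>\<zeta>. norm (exp \<zeta>) < r \<Longrightarrow> p \<zeta> = exp (\<mu> * \<zeta>) * P (exp \<zeta>)"
    and qQ: "\<And>\<zeta>. norm (exp \<zeta>) < r \<Longrightarrow> q \<zeta> = exp (\<mu> * \<zeta>) * Q (exp \<zeta>)"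
    and P0: "P 0 = 1"
  shows "p \<zeta> = exp (\<mu> * \<zeta>) * eval_fps (kummer_fps \<mu>) (exp \<zeta>)"
proof -
  obtain A B where A: "P has_fps_expansion A" and B: "Q has_fps_expansion B"
    and rA: "\<And>k. (of_nat k + \<mu>) * fps_nth A k = (if k = 0 then 0 else fps_nth A (k - 1)) + \<mu> * fps_nth B k"
    and rB: "\<And>k. (of_nat k + \<mu>) * fps_nth B k = \<mu> * fps_nth A k"
    using frobenius_recursion[OF dp dq r P Q pP qQ] by blast
  have "fps_nth A k = fps_nth (kummer_fps \<mu>) k" for k
  proof (induction k)
    case 0
    then show ?case using has_fps_expansion_imp_0_eq_fps_nth_0[OF A] P0 by (simp add: kummer_fps_def)
  next
    case (Suc k)
    let ?k = "of_nat (Suc k) :: complex"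
    have "(?k + \<mu>) * ((?k + \<mu>) * fps_nth A (Suc k)) = (?k + \<mu>) * fps_nth A k + \<mu> * ((?k + \<mu>) * fps_nth B (Suc k))"
      using rA[of "Suc k"] by (simp add: algebra_simps)
    also have "(?k + \<mu>) * fps_nth B (Suc k) = \<mu> * fps_nth A (Suc k)" by (rule rB)
    finally have "?k * (?k + 2 * \<mu>) * fps_nth A (Suc k) = (?k + \<mu>) * fps_nth A k"
      by (simp add: algebra_simps)
    also have "\<dots> = ?k * (?k + 2 * \<mu>) * fps_nth (kummer_fps \<mu>) (Suc k)"
      using kummer_fps_nth_Suc[OF \<mu>, of k] Suc by simp
    finally show ?case using of_nat_plus_ne_0[OF \<mu>, of "Suc k"] by (simp del: of_nat_Suc)
  qed
  then have AK: "A = kummer_fps \<mu>" by (simp add: fps_eq_iff)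
  show ?thesis
  proof (rule entire_eq_if_eq_on_left_half_plane[where f = p and
        g = "\<lambda>\<zeta>. exp (\<mu> * \<zeta>) * eval_fps (kummer_fps \<mu>) (exp \<zeta>)", OF _ _ r])
    show "p holomorphic_on UNIV" using dp by (auto simp: holomorphic_on_open)
    show "(\<lambda>\<zeta>. exp (\<mu> * \<zeta>) * eval_fps (kummer_fps \<mu>) (exp \<zeta>)) holomorphic_on UNIV"
      by (intro holomorphic_intros holomorphic_on_compose_gen[of exp UNIV _ UNIV, unfolded o_def])
         (auto intro!: holomorphic_intros simp: fps_conv_radius_kummer_fps[OF \<mu>])
    fix \<zeta> :: complex assume "norm (exp \<zeta>) < r"
    then show "p \<zeta> = exp (\<mu> * \<zeta>) * eval_fps (kummer_fps \<mu>) (exp \<zeta>)"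
      using pP has_fps_expansion_imp_eval_fps_eq[OF A _ P] AK by simp
  qed
qed

text \<open>The system is invariant under \<open>(p, q)(z) \<mapsto> exp z (q, p)(- z)\<close>, which replaces Kummer's
  transformation and reduces the asymptotics of \<open>q\<close> along \<open>arg z = - \<pi>\<close> to those of \<open>p\<close>
  along \<open>arg z = 0\<close>.\<close>

lemma frobenius_solution_rotated:
  fixes p q P Q :: "complex \<Rightarrow> complex" and \<mu> :: complex
  assumes \<mu>: "2 * \<mu> \<notin> \<int>"
    and dp: "\<And>\<zeta>. (p has_field_derivative exp \<zeta> * p \<zeta> + \<mu> * q \<zeta>) (at \<zeta>)"
    and dq: "\<And>\<zeta>. (q has_field_derivative \<mu> * p \<zeta>) (at \<zeta>)"
    and r: "r > 0" and P: "P holomorphic_on ball 0 r" and Q: "Q holomorphic_on ball 0 r"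
    and pP: "\<And>\<zeta>. norm (exp \<zeta>) < r \<Longrightarrow> p \<zeta> = exp (\<mu> * \<zeta>) * P (exp \<zeta>)"
    and qQ: "\<And>\<zeta>. norm (exp \<zeta>) < r \<Longrightarrow> q \<zeta> = exp (\<mu> * \<zeta>) * Q (exp \<zeta>)"
    and Q0: "Q 0 = 1"
  shows "q (\<zeta> - \<i> * pi) = exp (- \<i> * pi * \<mu>) * exp (- exp \<zeta>) * exp (\<mu> * \<zeta>) * eval_fps (kummer_fps \<mu>) (exp \<zeta>)"
proof -
  \<comment> \<open>Compensates the factor that \<open>exp (\<mu> * \<zeta>)\<close> acquires under
    the half turn \<open>\<zeta> - \<i> * pi\<close>.\<close>
  let ?c = "exp (\<i> * pi * \<mu>)"
  have e: "exp (\<zeta> - \<i> * pi) = - exp \<zeta>" for \<zeta> by (simp add: exp_diff)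
  have sh: "((\<lambda>\<zeta>. h (\<zeta> - \<i> * pi)) has_field_derivative D) (at \<zeta>)"
    if "(h has_field_derivative D) (at (\<zeta> - \<i> * pi))" for h D \<zeta>
  proof -
    have "((\<lambda>\<zeta>. \<zeta> - \<i> * pi) has_field_derivative 1) (at \<zeta>)"
      by (auto intro!: derivative_eq_intros)
    from DERIV_chain2[where f = h and g = "\<lambda>\<zeta>. \<zeta> - \<i> * pi", OF that this] show ?thesis by simp
  qed
  have dE: "((\<lambda>\<zeta>. ?c * exp (exp \<zeta>)) has_field_derivative ?c * exp (exp \<zeta>) * exp \<zeta>) (at \<zeta>)" for \<zeta>
    by (auto intro!: derivative_eq_intros)
  have "?c * exp (exp \<zeta>) * q (\<zeta> - \<i> * pi) = exp (\<mu> * \<zeta>) * eval_fps (kummer_fps \<mu>) (exp \<zeta>)"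
  \<comment> \<open>The roles of \<open>P\<close> and \<open>Q\<close> are exchanged, so that
    \<open>Q 0 = 1\<close> supplies the normalisation.\<close>
  proof (rule frobenius_solution[OF \<mu>, where P = "\<lambda>z. exp z * Q (- z)" and Q = "\<lambda>z. exp z * P (- z)" and r = r
        and q = "\<lambda>\<zeta>. ?c * exp (exp \<zeta>) * p (\<zeta> - \<i> * pi)" and p = "\<lambda>\<zeta>. ?c * exp (exp \<zeta>) * q (\<zeta> - \<i> * pi)"])
    fix \<zeta> :: complex
    show "((\<lambda>\<zeta>. ?c * exp (exp \<zeta>) * q (\<zeta> - \<i> * pi)) has_field_derivative
        exp \<zeta> * (?c * exp (exp \<zeta>) * q (\<zeta> - \<i> * pi)) + \<mu> * (?c * exp (exp \<zeta>) * p (\<zeta> - \<i> * pi))) (at \<zeta>)"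
      by (rule DERIV_cong[OF DERIV_mult[OF dE sh[OF dq]]]) (simp add: algebra_simps)
    show "((\<lambda>\<zeta>. ?c * exp (exp \<zeta>) * p (\<zeta> - \<i> * pi)) has_field_derivative
        \<mu> * (?c * exp (exp \<zeta>) * q (\<zeta> - \<i> * pi))) (at \<zeta>)"
      by (rule DERIV_cong[OF DERIV_mult[OF dE sh[OF dp]]]) (simp add: e algebra_simps)
  next
    have "(\<lambda>z. R (- z)) holomorphic_on ball 0 r" if "R holomorphic_on ball 0 r" for R :: "complex \<Rightarrow> complex"
      using that by (intro holomorphic_on_compose_gen[of uminus _ R "ball 0 r", unfolded o_def] holomorphic_intros) auto
    then show "(\<lambda>z. exp z * Q (- z)) holomorphic_on ball 0 r" "(\<lambda>z. exp z * P (- z)) holomorphic_on ball 0 r"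
      using P Q by (intro holomorphic_intros; blast)+
  next
    fix \<zeta> :: complex assume \<zeta>: "norm (exp \<zeta>) < r"
    have "?c * exp (\<mu> * (\<zeta> - \<i> * pi)) = exp (\<mu> * \<zeta>)"
      by (simp add: exp_add[symmetric] algebra_simps)
    moreover have "norm (exp (\<zeta> - \<i> * pi)) < r" using \<zeta> by (simp add: e)
    ultimately show "?c * exp (exp \<zeta>) * q (\<zeta> - \<i> * pi) = exp (\<mu> * \<zeta>) * (exp (exp \<zeta>) * Q (- exp \<zeta>))"
      "?c * exp (exp \<zeta>) * p (\<zeta> - \<i> * pi) = exp (\<mu> * \<zeta>) * (exp (exp \<zeta>) * P (- exp \<zeta>))"
      using pP[of "\<zeta> - \<i> * pi"] qQ[of "\<zeta> - \<i> * pi"] by (simp_all add: e mult_ac)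
  qed (use r Q0 in auto)
  then have "?c * (exp (exp \<zeta>) * q (\<zeta> - \<i> * pi)) = exp (\<mu> * \<zeta>) * eval_fps (kummer_fps \<mu>) (exp \<zeta>)"
    by (simp add: mult.assoc)
  then show ?thesis by (simp add: exp_minus field_simps)
qed

text \<open>The indicial factor \<open>k\<^sup>2 - \<mu>\<^sup>2\<close> has no zero at an integer
  \<open>k\<close>, so all coefficients of \<open>P\<close> vanish successively; then
  \<open>p = 0\<close> forces \<open>\<mu> * q = 0\<close>.\<close>

lemma frobenius_solution_exponent_0:
  fixes p q P Q :: "complex \<Rightarrow> complex" and \<mu> :: complex
  assumes \<mu>: "2 * \<mu> \<notin> \<int>"
    and dp: "\<And>\<zeta>. (p has_field_derivative exp \<zeta> * p \<zeta> + \<mu> * q \<zeta>) (at \<zeta>)"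
    and dq: "\<And>\<zeta>. (q has_field_derivative \<mu> * p \<zeta>) (at \<zeta>)"
    and r: "r > 0" and P: "P holomorphic_on ball 0 r" and Q: "Q holomorphic_on ball 0 r"
    and pP: "\<And>\<zeta>. norm (exp \<zeta>) < r \<Longrightarrow> p \<zeta> = P (exp \<zeta>)"
    and qQ: "\<And>\<zeta>. norm (exp \<zeta>) < r \<Longrightarrow> q \<zeta> = Q (exp \<zeta>)"
  shows "p \<zeta> = 0" "q \<zeta> = 0"
proof -
  obtain A B where A: "P has_fps_expansion A" and B: "Q has_fps_expansion B"
    and rA: "\<And>k. of_nat k * fps_nth A k = (if k = 0 then 0 else fps_nth A (k - 1)) + \<mu> * fps_nth B k"
    and rB: "\<And>k. of_nat k * fps_nth B k = \<mu> * fps_nth A k"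
    using frobenius_recursion[OF dp dq r P Q, of 0] pP qQ by auto
  have \<mu>0: "\<mu> \<noteq> 0" using \<mu> by auto
  have "fps_nth A k = 0" for k
  proof (induction k)
    case 0
    then show ?case using rB[of 0] \<mu>0 by simp
  next
    case (Suc k)
    let ?k = "of_nat (Suc k) :: complex"
    have "?k * (?k * fps_nth A (Suc k)) = \<mu> * (?k * fps_nth B (Suc k))"
      using rA[of "Suc k"] Suc by (simp add: algebra_simps)
    also have "?k * fps_nth B (Suc k) = \<mu> * fps_nth A (Suc k)" by (rule rB)
    finally have "(?k + \<mu>) * (?k - \<mu>) * fps_nth A (Suc k) = 0" by (simp add: algebra_simps)
    moreover have "?k + \<mu> \<noteq> 0" using of_nat_plus_ne_0(1)[OF \<mu>] .
    moreover have "?k - \<mu> \<noteq> 0" using of_nat_plus_ne_0(1)[of "- \<mu>" "Suc k"] \<mu> by simp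
    ultimately show ?case by auto
  qed
  then have A0: "A = 0" by (simp add: fps_eq_iff)
  have p0: "p \<zeta> = 0" for \<zeta>
  proof (rule entire_eq_if_eq_on_left_half_plane[where f = p and g = "\<lambda>_. 0", OF _ _ r])
    show "p holomorphic_on UNIV" using dp by (auto simp: holomorphic_on_open)
    fix \<zeta> :: complex assume "norm (exp \<zeta>) < r"
    then show "p \<zeta> = 0" using pP has_fps_expansion_imp_eval_fps_eq[OF A _ P] A0 by simp
  qed auto
  then have p0': "p = (\<lambda>_. 0)" by auto
  then show "p \<zeta> = 0" by simp
  from dp[of \<zeta>] show "q \<zeta> = 0" using \<mu>0 DERIV_unique[OF _ DERIV_const] unfolding p0' by fastforce
qed

section \<open>The connection matrix\<close>

text \<open>The Abelian theorem at the positive real point \<open>exp x\<close>, with the Pochhammer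
  quotient as coefficient sequence; the difference of its parameters \<open>1 + 2 * \<mu>\<close>
  and \<open>1 + \<mu>\<close> is exactly the exponent \<open>\<mu>\<close>.\<close>

lemma kummer_fps_tendsto:
  assumes \<mu>: "2 * \<mu> \<notin> \<int>"
  shows "((\<lambda>x::real. exp (- exp (of_real x)) * exp (\<mu> * of_real x) * eval_fps (kummer_fps \<mu>) (exp (of_real x)))
    \<longlongrightarrow> Gamma (1 + 2 * \<mu>) / Gamma (1 + \<mu>)) at_top"
proof -
  have "1 + 2 * \<mu> \<notin> \<int>\<^sub>\<le>\<^sub>0"
  proof
    assume "1 + 2 * \<mu> \<in> \<int>\<^sub>\<le>\<^sub>0"
    from Ints_diff[OF nonpos_Ints_Int[OF this] Ints_1] \<mu> show False by simp
  qed
  from pochhammer_ratio_tendsto[OF this, of "1 + \<mu>"]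
  have "(\<lambda>n. pochhammer (1 + \<mu>) n / pochhammer (1 + 2 * \<mu>) n * of_nat (Suc n) powr \<mu>)
      \<longlonglongrightarrow> Gamma (1 + 2 * \<mu>) / Gamma (1 + \<mu>)"
    by simp
  from filterlim_compose[OF exp_powr_series_tendsto[OF this] exp_at_top]
  show ?thesis
    by (simp add: eval_fps_def kummer_fps_def powr_def Ln_of_real exp_of_real)
qed

section \<open>The system in the variables \<open>p\<close> and \<open>q\<close>\<close>

lemma fundamental_solution_deriv:
  assumes "fundamental_solution \<mu> Y"
  shows "((\<lambda>\<xi>. Y \<xi> $ 1 $ j + Y \<xi> $ 3 $ j) has_field_derivative
            exp \<zeta> * (Y \<zeta> $ 1 $ j + Y \<zeta> $ 3 $ j) + \<mu> * (Y \<zeta> $ 1 $ j - Y \<zeta> $ 3 $ j)) (at \<zeta>)"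
    and "((\<lambda>\<xi>. Y \<xi> $ 1 $ j - Y \<xi> $ 3 $ j) has_field_derivative
            \<mu> * (Y \<zeta> $ 1 $ j + Y \<zeta> $ 3 $ j)) (at \<zeta>)"
    and "((\<lambda>\<xi>. Y \<xi> $ 2 $ j) has_field_derivative 0) (at \<zeta>)"
proof -
  have d: "((\<lambda>\<xi>. Y \<xi> $ i $ j) has_field_derivative
            exp \<zeta> * (coeff_matrix \<mu> (exp \<zeta>) ** Y \<zeta>) $ i $ j) (at \<zeta>)" for i
    using assms unfolding fundamental_solution_def by blast
  have e: "exp \<zeta> * (coeff_matrix \<mu> (exp \<zeta>) ** Y \<zeta>) $ 1 $ j
        = exp \<zeta> / 2 * (Y \<zeta> $ 1 $ j + Y \<zeta> $ 3 $ j) + \<mu> * Y \<zeta> $ 1 $ j"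
      "exp \<zeta> * (coeff_matrix \<mu> (exp \<zeta>) ** Y \<zeta>) $ 2 $ j = 0"
      "exp \<zeta> * (coeff_matrix \<mu> (exp \<zeta>) ** Y \<zeta>) $ 3 $ j
        = exp \<zeta> / 2 * (Y \<zeta> $ 1 $ j + Y \<zeta> $ 3 $ j) - \<mu> * Y \<zeta> $ 3 $ j"
    by (simp_all add: coeff_matrix_def diag3_def mat_def matrix_matrix_mult_def sum_3 field_simps)
  note d' = d[of 1, unfolded e] d[of 2, unfolded e] d[of 3, unfolded e]
  show "((\<lambda>\<xi>. Y \<xi> $ 1 $ j + Y \<xi> $ 3 $ j) has_field_derivative
            exp \<zeta> * (Y \<zeta> $ 1 $ j + Y \<zeta> $ 3 $ j) + \<mu> * (Y \<zeta> $ 1 $ j - Y \<zeta> $ 3 $ j)) (at \<zeta>)"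
    by (rule DERIV_cong[OF DERIV_add[OF d'(1) d'(3)]]) (simp add: field_simps)
  show "((\<lambda>\<xi>. Y \<xi> $ 1 $ j - Y \<xi> $ 3 $ j) has_field_derivative
            \<mu> * (Y \<zeta> $ 1 $ j + Y \<zeta> $ 3 $ j)) (at \<zeta>)"
    by (rule DERIV_cong[OF DERIV_diff[OF d'(1) d'(3)]]) (simp add: field_simps)
  show "((\<lambda>\<xi>. Y \<xi> $ 2 $ j) has_field_derivative 0) (at \<zeta>)" by (rule d'(2))
qed

lemma fundamental_solution_second_row:
  assumes "fundamental_solution \<mu> Y"
  shows "Y \<zeta> $ 2 $ j = Y \<xi> $ 2 $ j"
  using has_field_derivative_zero_constant[of UNIV "\<lambda>\<xi>. Y \<xi> $ 2 $ j"]
    fundamental_solution_deriv(3)[OF assms] by (metis UNIV_I convex_UNIV)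

text \<open>Liouville's formula: in the coordinate \<open>\<zeta>\<close> the system for
  \<open>p\<close>, \<open>q\<close> has trace \<open>exp \<zeta>\<close>.\<close>

lemma wronskian_eq:
  fixes p q p' q' :: "complex \<Rightarrow> complex"
  assumes "\<And>\<zeta>. (p has_field_derivative exp \<zeta> * p \<zeta> + \<mu> * q \<zeta>) (at \<zeta>)"
    and "\<And>\<zeta>. (q has_field_derivative \<mu> * p \<zeta>) (at \<zeta>)"
    and "\<And>\<zeta>. (p' has_field_derivative exp \<zeta> * p' \<zeta> + \<mu> * q' \<zeta>) (at \<zeta>)"
    and "\<And>\<zeta>. (q' has_field_derivative \<mu> * p' \<zeta>) (at \<zeta>)"
  obtains c where "\<And>\<zeta>. p \<zeta> * q' \<zeta> - p' \<zeta> * q \<zeta> = c * exp (exp \<zeta>)"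
proof -
  have "((\<lambda>\<zeta>. (p \<zeta> * q' \<zeta> - p' \<zeta> * q \<zeta>) * exp (- exp \<zeta>)) has_field_derivative 0) (at \<zeta>)" for \<zeta>
  proof -
    have "((\<lambda>\<zeta>. exp (- exp \<zeta>)) has_field_derivative - (exp \<zeta> * exp (- exp \<zeta>))) (at \<zeta>)"
      by (auto intro!: derivative_eq_intros)
    from DERIV_mult[OF DERIV_diff[OF DERIV_mult[OF assms(1,4)] DERIV_mult[OF assms(3,2)]] this]
    show ?thesis by (rule DERIV_cong) (simp add: algebra_simps)
  qed
  then obtain c where c: "\<And>\<zeta>. (p \<zeta> * q' \<zeta> - p' \<zeta> * q \<zeta>) * exp (- exp \<zeta>) = c"
    using has_field_derivative_zero_constant[of UNIV] by (metis (no_types, lifting) UNIV_I convex_UNIV)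
  show thesis
  proof (rule that)
    fix \<zeta> show "p \<zeta> * q' \<zeta> - p' \<zeta> * q \<zeta> = c * exp (exp \<zeta>)"
      unfolding c[of \<zeta>, symmetric] by (simp add: exp_minus)
  qed
qed

text \<open>Column 1 has exponent \<open>\<mu>\<close>, column 3 the same form with
  \<open>- \<mu>\<close>, and column 2 exponent 0. The second row is constant, and its entries are
  settled by monodromy and by the limit at \<open>z = 0\<close>.\<close>

lemma fundamental_solution_at_0_entries:
  assumes \<mu>: "2 * \<mu> \<notin> \<int>" and Y: "fundamental_solution_at_0 \<mu> Y"
  shows "Y \<zeta> $ 1 $ 1 + Y \<zeta> $ 3 $ 1 = exp (\<mu> * \<zeta>) * eval_fps (kummer_fps \<mu>) (exp \<zeta>)" (is ?A1)
    and "Y \<zeta> $ 1 $ 3 + Y \<zeta> $ 3 $ 3 = exp (- \<mu> * \<zeta>) * eval_fps (kummer_fps (- \<mu>)) (exp \<zeta>)" (is ?A2)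
    and "Y (\<zeta> - \<i> * pi) $ 1 $ 1 - Y (\<zeta> - \<i> * pi) $ 3 $ 1
      = exp (- \<i> * pi * \<mu>) * exp (- exp \<zeta>) * exp (\<mu> * \<zeta>) * eval_fps (kummer_fps \<mu>) (exp \<zeta>)" (is ?A3)
    and "Y (\<zeta> - \<i> * pi) $ 3 $ 3 - Y (\<zeta> - \<i> * pi) $ 1 $ 3
      = exp (\<i> * pi * \<mu>) * exp (- exp \<zeta>) * exp (- \<mu> * \<zeta>) * eval_fps (kummer_fps (- \<mu>)) (exp \<zeta>)" (is ?A4)
    and "Y \<zeta> $ 1 $ 2 = 0" and "Y \<zeta> $ 2 $ 2 = 1" and "Y \<zeta> $ 3 $ 2 = 0"
    and "Y \<zeta> $ 2 $ 1 = 0" and "Y \<zeta> $ 2 $ 3 = 0"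
proof -
  from Y have F: "fundamental_solution \<mu> Y" by (simp add: fundamental_solution_at_0_def)
  from Y obtain G P r where G0: "G 0 = mat 1" and r: "r > 0"
    and sums: "\<And>z. norm z < r \<Longrightarrow> (\<lambda>k. mat (z ^ k) ** G k) sums P z"
    and YP: "\<And>\<zeta>. norm (exp \<zeta>) < r \<Longrightarrow> Y \<zeta> = P (exp \<zeta>) ** diag3 (exp (\<mu> * \<zeta>)) 1 (exp (- \<mu> * \<zeta>))"
    unfolding fundamental_solution_at_0_def by blast
  have entry_sums: "(\<lambda>k. G k $ i $ j * (z - 0) ^ k) sums (P z $ i $ j)" if "z \<in> ball 0 r" for z i j
  proof -
    have "bounded_linear (\<lambda>A::complex^3^3. A $ i $ j)"
      by (intro bounded_linear_compose[OF bounded_linear_vec_nth bounded_linear_vec_nth])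
    from bounded_linear.sums[OF this sums[of z]] that
    have "(\<lambda>k. (mat (z ^ k) ** G k) $ i $ j) sums (P z $ i $ j)" by simp
    also have "(\<lambda>k. (mat (z ^ k) ** G k) $ i $ j) = (\<lambda>k. G k $ i $ j * (z - 0) ^ k)"
      using exhaust_3[of i] by (auto simp: fun_eq_iff mat_def matrix_matrix_mult_def sum_3)
    finally show ?thesis .
  qed
  have hol: "(\<lambda>z. P z $ i $ j) holomorphic_on ball 0 r" for i j
    using entry_sums by (rule power_series_holomorphic)
  have P0: "P 0 $ i $ j = (if i = j then 1 else 0)" for i j
  proof -
    have "(\<lambda>k. G k $ i $ j * (0 - 0) ^ k) sums (G 0 $ i $ j)"
      using powser_sums_zero[of "\<lambda>k. G k $ i $ j"] by simp
    moreover have "(\<lambda>k. G k $ i $ j * (0 - 0) ^ k) sums (P 0 $ i $ j)"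
      using r by (intro entry_sums) auto
    ultimately show ?thesis using G0 by (auto simp: mat_def dest: sums_unique2)
  qed
  have YP': "Y \<zeta> $ i $ 1 = exp (\<mu> * \<zeta>) * P (exp \<zeta>) $ i $ 1" "Y \<zeta> $ i $ 2 = P (exp \<zeta>) $ i $ 2"
       "Y \<zeta> $ i $ 3 = exp (- \<mu> * \<zeta>) * P (exp \<zeta>) $ i $ 3" if "norm (exp \<zeta>) < r" for \<zeta> i
    using YP[OF that] by (simp_all add: matrix_matrix_mult_def sum_3 diag3_def)
  have \<mu>': "2 * (- \<mu>) \<notin> \<int>" using \<mu> by simp
  note d = fundamental_solution_deriv[OF F]
  \<comment> \<open>Changing the sign of \<open>q\<close> turns the system for \<open>\<mu>\<close>
    into the one for \<open>- \<mu>\<close>; for column 3 it also gives the value 1 to the power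
    series of \<open>- q\<close> at 0.\<close>
  have d3: "((\<lambda>\<zeta>. Y \<zeta> $ 1 $ 3 + Y \<zeta> $ 3 $ 3) has_field_derivative
      exp \<zeta> * (Y \<zeta> $ 1 $ 3 + Y \<zeta> $ 3 $ 3) + - \<mu> * (Y \<zeta> $ 3 $ 3 - Y \<zeta> $ 1 $ 3)) (at \<zeta>)"
    "((\<lambda>\<zeta>. Y \<zeta> $ 3 $ 3 - Y \<zeta> $ 1 $ 3) has_field_derivative - \<mu> * (Y \<zeta> $ 1 $ 3 + Y \<zeta> $ 3 $ 3)) (at \<zeta>)" for \<zeta>
    using d(1)[of 3] DERIV_minus[OF d(2)[of 3]] by (simp_all add: algebra_simps)
  have h: "(\<lambda>z. P z $ i $ j + P z $ i' $ j) holomorphic_on ball 0 r"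
          "(\<lambda>z. P z $ i $ j - P z $ i' $ j) holomorphic_on ball 0 r" for i i' j
    by (intro holomorphic_intros hol)+
  show ?A1
    by (rule frobenius_solution[OF \<mu> d(1)[of 1] d(2)[of 1] r h(1)[of 1 1 3] h(2)[of 1 1 3]])
       (auto simp: YP' P0 algebra_simps)
  show ?A3
    by (rule frobenius_solution_rotated[OF \<mu> d(1)[of 1] d(2)[of 1] r h(1)[of 1 1 3] h(2)[of 1 1 3]])
       (auto simp: YP' P0 algebra_simps)
  show ?A2
    by (rule frobenius_solution[OF \<mu>' d3 r h(1)[of 1 3 3] h(2)[of 3 3 1]])
       (auto simp: YP' P0 algebra_simps)
  have "Y (\<zeta> - \<i> * pi) $ 3 $ 3 - Y (\<zeta> - \<i> * pi) $ 1 $ 3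
      = exp (- \<i> * pi * (- \<mu>)) * exp (- exp \<zeta>) * exp (- \<mu> * \<zeta>) * eval_fps (kummer_fps (- \<mu>)) (exp \<zeta>)"
    by (rule frobenius_solution_rotated[OF \<mu>' d3 r h(1)[of 1 3 3] h(2)[of 3 3 1]])
       (auto simp: YP' P0 algebra_simps)
  then show ?A4 by simp
  have "Y \<zeta> $ 1 $ 2 + Y \<zeta> $ 3 $ 2 = 0"
    by (rule frobenius_solution_exponent_0(1)[OF \<mu> d(1)[of 2] d(2)[of 2] r h(1)[of 1 2 3] h(2)[of 1 2 3]])
       (auto simp: YP')
  moreover have "Y \<zeta> $ 1 $ 2 - Y \<zeta> $ 3 $ 2 = 0"
    by (rule frobenius_solution_exponent_0(2)[OF \<mu> d(1)[of 2] d(2)[of 2] r h(1)[of 1 2 3] h(2)[of 1 2 3]])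
       (auto simp: YP')
  ultimately show "Y \<zeta> $ 1 $ 2 = 0" "Y \<zeta> $ 3 $ 2 = 0"
    by (simp_all add: eq_neg_iff_add_eq_0)
  \<comment> \<open>A base point where the series represents the solution. One turn to
    \<open>\<zeta>0 + 2 * pi * \<i>\<close> multiplies the entries (2,1) and (2,3) by factors
    different from 1, yet leaves them unchanged by constancy, so they vanish.\<close>
  define \<zeta>0 :: complex where "\<zeta>0 = of_real (ln (r / 2))"
  have \<zeta>0: "norm (exp \<zeta>0) < r" using r by (simp add: \<zeta>0_def)
  have e1: "exp (2 * pi * \<i> * \<nu>) \<noteq> 1" if \<nu>: "2 * \<nu> \<notin> \<int>" for \<nu> :: complex
  proof
    assume "exp (2 * pi * \<i> * \<nu>) = 1"
    then obtain n :: int where "Im \<nu> = 0" "Re \<nu> = n"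
      by (auto simp: exp_eq_1)
    then have "2 * \<nu> = of_int (2 * n)" by (simp add: complex_eq_iff)
    with \<nu> show False by simp
  qed
  have period: "exp (\<nu> * (\<zeta>0 + 2 * pi * \<i>)) = exp (\<nu> * \<zeta>0) * exp (2 * pi * \<i> * \<nu>)"
               "exp (\<zeta>0 + 2 * pi * \<i>) = exp \<zeta>0" for \<nu>
    by (simp add: exp_add[symmetric] algebra_simps, use exp_two_pi_i in \<open>simp add: exp_add mult_ac\<close>)
  have \<zeta>1: "norm (exp (\<zeta>0 + 2 * pi * \<i>)) < r" using \<zeta>0 by (simp only: period(2))
  have "Y \<zeta>0 $ 2 $ 1 = Y (\<zeta>0 + 2 * pi * \<i>) $ 2 $ 1"
    by (rule fundamental_solution_second_row[OF F])
  also have "\<dots> = exp (\<mu> * (\<zeta>0 + 2 * pi * \<i>)) * P (exp (\<zeta>0 + 2 * pi * \<i>)) $ 2 $ 1"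
    by (rule YP'(1)[OF \<zeta>1])
  also have "\<dots> = exp (\<mu> * \<zeta>0) * P (exp \<zeta>0) $ 2 $ 1 * exp (2 * pi * \<i> * \<mu>)"
    by (simp only: period) (simp only: mult.assoc mult.commute mult.left_commute)
  also have "exp (\<mu> * \<zeta>0) * P (exp \<zeta>0) $ 2 $ 1 = Y \<zeta>0 $ 2 $ 1"
    by (rule YP'(1)[OF \<zeta>0, symmetric])
  finally show "Y \<zeta> $ 2 $ 1 = 0"
    using e1[OF \<mu>] fundamental_solution_second_row[OF F, of \<zeta> 1 \<zeta>0] by simp
  have "Y \<zeta>0 $ 2 $ 3 = Y (\<zeta>0 + 2 * pi * \<i>) $ 2 $ 3"
    by (rule fundamental_solution_second_row[OF F])
  also have "\<dots> = exp (- \<mu> * (\<zeta>0 + 2 * pi * \<i>)) * P (exp (\<zeta>0 + 2 * pi * \<i>)) $ 2 $ 3"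
    by (rule YP'(3)[OF \<zeta>1])
  also have "\<dots> = exp (- \<mu> * \<zeta>0) * P (exp \<zeta>0) $ 2 $ 3 * exp (2 * pi * \<i> * (- \<mu>))"
    by (simp only: period) (simp only: mult.assoc mult.commute mult.left_commute)
  also have "exp (- \<mu> * \<zeta>0) * P (exp \<zeta>0) $ 2 $ 3 = Y \<zeta>0 $ 2 $ 3"
    by (rule YP'(3)[OF \<zeta>0, symmetric])
  finally show "Y \<zeta> $ 2 $ 3 = 0"
    using e1[OF \<mu>'] fundamental_solution_second_row[OF F, of \<zeta> 3 \<zeta>0] by simp
  \<comment> \<open>\<open>at_bot\<close> for \<open>log z\<close> is the approach to
    \<open>z = 0\<close>, where the series takes the value 1.\<close>
  have lim: "((\<lambda>x::real. P (exp (of_real x)) $ 2 $ 2) \<longlongrightarrow> 1) at_bot"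
  proof -
    have "isCont (\<lambda>z. P z $ 2 $ 2) 0"
      using hol r by (meson centre_in_ball holomorphic_on_imp_continuous_on continuous_on_interior interior_ball open_ball continuous_on_eq_continuous_at)
    moreover have "((\<lambda>x::real. exp (of_real x) :: complex) \<longlongrightarrow> 0) at_bot"
      using tendsto_of_real[OF exp_at_bot, where 'a = complex] by (simp add: exp_of_real)
    ultimately show ?thesis
      using isCont_tendsto_compose P0[of 2 2] by fastforce
  qed
  have "eventually (\<lambda>x::real. Y \<zeta> $ 2 $ 2 = P (exp (of_real x)) $ 2 $ 2) at_bot"
    using eventually_le_at_bot[of "ln (r/2)"]
  proof eventually_elim
    case (elim x)
    have "exp x \<le> r / 2" using elim r by (metis exp_le_cancel_iff exp_ln half_gt_zero)
    then have "norm (exp (of_real x :: complex)) < r" using r by simp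
    from YP'(2)[OF this] show ?case using fundamental_solution_second_row[OF F] by metis
  qed
  then have "((\<lambda>x::real. P (exp (of_real x)) $ 2 $ 2) \<longlongrightarrow> Y \<zeta> $ 2 $ 2) at_bot"
    by (rule tendsto_eventually[OF eventually_mono]) auto
  with lim show "Y \<zeta> $ 2 $ 2 = 1" by (intro tendsto_unique[OF _ _ lim]) auto
qed

section \<open>Existence and uniqueness of the connection matrix\<close>

text \<open>Cramer's rule in \<open>p\<close>, \<open>q\<close>: all Wronskians are constant
  multiples of the same \<open>exp (exp \<zeta>)\<close>, so the coefficients expressing
  \<open>Z\<close> through \<open>Y\<close> are constant.\<close>

lemma connection_matrix_exists:
  assumes \<mu>: "2 * \<mu> \<notin> \<int>" and Y: "fundamental_solution_at_0 \<mu> Y" and Z: "fundamental_solution \<mu> Z"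
  obtains C where "\<And>\<zeta>. Z \<zeta> = Y \<zeta> ** C"
proof -
  from Y have F: "fundamental_solution \<mu> Y" by (simp add: fundamental_solution_at_0_def)
  note y = fundamental_solution_at_0_entries(5-)[OF \<mu> Y]
  let ?p = "\<lambda>Y j \<zeta>. Y \<zeta> $ 1 $ j + Y \<zeta> $ 3 $ j :: complex"
  let ?q = "\<lambda>Y j \<zeta>. Y \<zeta> $ 1 $ j - Y \<zeta> $ 3 $ j :: complex"
  have W: "\<exists>c. \<forall>\<zeta>. ?p U j \<zeta> * ?q V k \<zeta> - ?p V k \<zeta> * ?q U j \<zeta> = c * exp (exp \<zeta>)"
    if "fundamental_solution \<mu> U" "fundamental_solution \<mu> V" for U V and j k :: 3
    using wronskian_eq[OF fundamental_solution_deriv(1,2)[OF that(1), of j] fundamental_solution_deriv(1,2)[OF that(2), of k]]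
    by blast
  obtain w where w: "\<And>\<zeta>. ?p Y 1 \<zeta> * ?q Y 3 \<zeta> - ?p Y 3 \<zeta> * ?q Y 1 \<zeta> = w * exp (exp \<zeta>)"
    using W[OF F F, of 1 3] by blast
  \<comment> \<open>The middle row and column of \<open>Y\<close> are those of the identity, so
    \<open>det Y\<close> is the remaining minor, and the Wronskian is -2 times that minor.\<close>
  have w0: "w \<noteq> 0"
  proof -
    have "det (Y 0) \<noteq> 0" using F by (simp add: fundamental_solution_def invertible_det_nz)
    moreover have "det (Y 0) = Y 0 $ 1 $ 1 * Y 0 $ 3 $ 3 - Y 0 $ 1 $ 3 * Y 0 $ 3 $ 1"
      by (simp add: det_3 y)
    moreover have "w * exp (exp 0) = - 2 * (Y 0 $ 1 $ 1 * Y 0 $ 3 $ 3 - Y 0 $ 1 $ 3 * Y 0 $ 3 $ 1)"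
      unfolding w[symmetric] by (simp add: algebra_simps)
    ultimately show ?thesis by auto
  qed
  obtain a where a: "\<And>j \<zeta>. ?p Z j \<zeta> * ?q Y 3 \<zeta> - ?p Y 3 \<zeta> * ?q Z j \<zeta> = a j * exp (exp \<zeta>)"
    using W[OF Z F, of _ 3] by metis
  obtain b where b: "\<And>j \<zeta>. ?p Y 1 \<zeta> * ?q Z j \<zeta> - ?p Z j \<zeta> * ?q Y 1 \<zeta> = b j * exp (exp \<zeta>)"
    using W[OF F Z, of 1] by metis
  define C :: "complex^3^3" where
    "C = (\<chi> i j. if i = 1 then a j / w else if i = 2 then Z 0 $ 2 $ j else b j / w)"
  have C: "C $ 1 $ j = a j / w" "C $ 2 $ j = Z 0 $ 2 $ j" "C $ 3 $ j = b j / w" for j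
    by (simp_all add: C_def)
  have cramer: "p = (p * q3 - p3 * q) / D * p1 + (p1 * q - p * q1) / D * p3 \<and>
      q = (p * q3 - p3 * q) / D * q1 + (p1 * q - p * q1) / D * q3"
    if "p1 * q3 - p3 * q1 = D" "D \<noteq> 0" for p q p1 q1 p3 q3 D :: complex
  proof -
    have "p * D = (p * q3 - p3 * q) * p1 + (p1 * q - p * q1) * p3"
         "q * D = (p * q3 - p3 * q) * q1 + (p1 * q - p * q1) * q3"
      unfolding that(1)[symmetric] by (simp_all add: algebra_simps)
    moreover have "x = a / D * b + c / D * d" if "x * D = a * b + c * d" for x a b c d
      using that \<open>D \<noteq> 0\<close> by (simp add: eq_divide_eq add_divide_distrib[symmetric])
    ultimately show ?thesis by blast
  qed
  show thesis
  proof (rule that)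
    fix \<zeta>
    have pq: "?p Z j \<zeta> = C $ 1 $ j * ?p Y 1 \<zeta> + C $ 3 $ j * ?p Y 3 \<zeta>"
         "?q Z j \<zeta> = C $ 1 $ j * ?q Y 1 \<zeta> + C $ 3 $ j * ?q Y 3 \<zeta>" for j
      using cramer[OF w[of \<zeta>], of "?p Z j \<zeta>" "?q Z j \<zeta>"] w0 unfolding a b by (simp_all add: C)
    have half: "x = ((x + y) + (x - y)) / 2" "y = ((x + y) - (x - y)) / 2" for x y :: complex
      by (simp_all add: field_simps)
    have "Z \<zeta> $ 1 $ j = C $ 1 $ j * Y \<zeta> $ 1 $ 1 + C $ 3 $ j * Y \<zeta> $ 1 $ 3" for j
      by (subst half(1)[of _ "Z \<zeta> $ 3 $ j"]) (simp only: pq, simp add: field_simps)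
    moreover have "Z \<zeta> $ 3 $ j = C $ 1 $ j * Y \<zeta> $ 3 $ 1 + C $ 3 $ j * Y \<zeta> $ 3 $ 3" for j
      by (subst half(2)[of _ "Z \<zeta> $ 1 $ j"]) (simp only: pq, simp add: field_simps)
    moreover have "Z \<zeta> $ 2 $ j = C $ 2 $ j" for j
      using fundamental_solution_second_row[OF Z] by (simp add: C)
    ultimately show "Z \<zeta> = Y \<zeta> ** C"
      by (simp add: vec_eq_iff forall_3 matrix_matrix_mult_def sum_3 y mult.commute)
  qed
qed

lemma connection_matrix_eq:
  assumes Y: "\<And>\<zeta>. invertible (Y \<zeta>)" and Z: "\<And>\<zeta>. Z \<zeta> = Y \<zeta> ** C"
  shows "connection_matrix Y Z = C"
  unfolding connection_matrix_def
proof (rule the_equality)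
  fix C' assume "\<forall>\<zeta>. Z \<zeta> = Y \<zeta> ** C'"
  then have "Y 0 ** C' = Y 0 ** C" using Z by metis
  moreover from Y obtain B where "B ** Y 0 = mat 1" by (auto simp: invertible_def)
  ultimately show "C' = C" by (metis matrix_mul_assoc matrix_mul_lid)
qed (use Z in auto)

section \<open>Limits along the rays \<open>arg z = 0\<close> and
  \<open>arg z = - pi\<close>\<close>

text \<open>Both rays lie inside the sector. On the first, division by \<open>exp z\<close> leaves
  only the third column in \<open>p\<close>; on the second, \<open>exp z\<close> decays and only the
  first two columns contribute to \<open>q\<close> and to the constant second row.\<close>

lemma fundamental_solution_at_infinity_limits:
  assumes inf: "fundamental_solution_at_infinity \<mu> s t Y" and st: "s\<^sup>2 + t\<^sup>2 = 1"
  shows "((\<lambda>x::real. exp (- exp (of_real x)) * (Y (of_real x) $ 1 $ j + Y (of_real x) $ 3 $ j))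
            \<longlongrightarrow> (if j = 3 then of_real (sqrt 2) else 0)) at_top" (is ?A)
    and "((\<lambda>x::real. Y (of_real x - \<i> * pi) $ 1 $ j - Y (of_real x - \<i> * pi) $ 3 $ j)
            \<longlongrightarrow> - \<i> * of_real (sqrt 2) * (if j = 1 then s else if j = 2 then t else 0)) at_top" (is ?B)
    and "Y \<zeta> $ 2 $ j = (if j = 1 then - t else if j = 2 then s else 0)" (is ?C)
proof -
  from inf have F: "fundamental_solution \<mu> Y" by (simp add: fundamental_solution_at_infinity_def)
  from inf obtain E where E: "\<And>\<zeta>. Psi s t ** Y \<zeta> = (mat 1 + E \<zeta>) ** diag3 1 1 (exp (exp \<zeta>))"
    and bigo: "\<And>a b i j. - 3 * pi / 2 < a \<Longrightarrow> a \<le> b \<Longrightarrow> b < pi / 2 \<Longrightarrow>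
               (\<lambda>\<zeta>. E \<zeta> $ i $ j) \<in> O[at_infinity_in_sector a b](\<lambda>\<zeta>. 1 / exp \<zeta>)"
    unfolding fundamental_solution_at_infinity_def by blast
  define M where "M \<zeta> = (mat 1 + E \<zeta>) ** diag3 1 1 (exp (exp \<zeta>))" for \<zeta>
  let ?r = "of_real (sqrt 2) :: complex"
  have r2: "?r * ?r = 2" by (simp flip: of_real_mult)
  have r0: "?r \<noteq> 0" by simp
  have PM: "Psi s t ** Y \<zeta> = M \<zeta>" for \<zeta> by (simp add: M_def E)
  have M1: "M \<zeta> $ 1 $ j = \<i> * s / ?r * (Y \<zeta> $ 1 $ j - Y \<zeta> $ 3 $ j) - t * Y \<zeta> $ 2 $ j"
   and M2: "M \<zeta> $ 2 $ j = \<i> * t / ?r * (Y \<zeta> $ 1 $ j - Y \<zeta> $ 3 $ j) + s * Y \<zeta> $ 2 $ j"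
   and M3: "M \<zeta> $ 3 $ j = (Y \<zeta> $ 1 $ j + Y \<zeta> $ 3 $ j) / ?r" for \<zeta>
    unfolding PM[symmetric]
    by (simp_all add: Psi_def matrix_matrix_mult_def sum_3 diff_divide_distrib add_divide_distrib algebra_simps)
  have st': "s * s + t * t = 1" using st by (simp add: power2_eq_square)
  have u: "Y \<zeta> $ 1 $ j + Y \<zeta> $ 3 $ j = ?r * M \<zeta> $ 3 $ j" for \<zeta> by (simp add: M3)
  \<comment> \<open>\<open>Psi\<close> is inverted by hand: this combination and the one for the
    second row are a rotation, inverted by means of \<open>s * s + t * t = 1\<close>.\<close>
  have v: "Y \<zeta> $ 1 $ j - Y \<zeta> $ 3 $ j = - \<i> * ?r * (s * M \<zeta> $ 1 $ j + t * M \<zeta> $ 2 $ j)" for \<zeta>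
  proof -
    have "s * M \<zeta> $ 1 $ j + t * M \<zeta> $ 2 $ j = (s * s + t * t) * (\<i> / ?r * (Y \<zeta> $ 1 $ j - Y \<zeta> $ 3 $ j))"
      unfolding M1 M2 by (simp add: algebra_simps add_divide_distrib)
    then show ?thesis by (simp add: st')
  qed
  have y2: "Y \<zeta> $ 2 $ j = s * M \<zeta> $ 2 $ j - t * M \<zeta> $ 1 $ j" for \<zeta>
  proof -
    have "s * M \<zeta> $ 2 $ j - t * M \<zeta> $ 1 $ j = (s * s + t * t) * Y \<zeta> $ 2 $ j"
      unfolding M1 M2 by (simp add: algebra_simps)
    then show ?thesis by (simp add: st')
  qed
  have E0: "((\<lambda>x::real. E (of_real x + \<i> * of_real a) $ i $ k) \<longlongrightarrow> 0) at_top"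
    if a: "- 3 * pi / 2 < a" "a < pi / 2" for a i k
  proof -
    \<comment> \<open>A single ray is the degenerate closed subsector with equal bounds.\<close>
    have fl: "filterlim (\<lambda>x::real. of_real x + \<i> * of_real a) (at_infinity_in_sector a a) at_top"
      unfolding at_infinity_in_sector_def filterlim_inf filterlim_principal filterlim_filtercomap_iff o_def
      by (auto simp: filterlim_ident)
    from bigo[OF a(1) order.refl a(2), of i k] obtain c
      where "eventually (\<lambda>\<zeta>. norm (E \<zeta> $ i $ k) \<le> c * norm (1 / exp \<zeta>)) (at_infinity_in_sector a a)"
      by (elim landau_o.bigE)
    from eventually_compose_filterlim[OF this fl]
    have "eventually (\<lambda>x::real. norm (E (of_real x + \<i> * of_real a) $ i $ k) \<le> c * exp (- x)) at_top"
      by (simp add: norm_divide norm_inverse exp_minus divide_inverse)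
    moreover have "((\<lambda>x::real. c * exp (- x)) \<longlongrightarrow> c * 0) at_top"
      by (intro tendsto_intros filterlim_compose[OF exp_at_bot filterlim_uminus_at_bot_at_top])
    ultimately show ?thesis by (simp add: Lim_null_comparison)
  qed
  have ME: "M \<zeta> $ i $ j = ((if i = j then 1 else 0) + E \<zeta> $ i $ j) * (if j = 3 then exp (exp \<zeta>) else 1)" for \<zeta> i
    using exhaust_3[of i] exhaust_3[of j]
    by (auto simp: M_def matrix_matrix_mult_def sum_3 diag3_def mat_def)
  have neg: "((\<lambda>x::real. exp (- exp (of_real x)) :: complex) \<longlongrightarrow> 0) at_top"
  proof -
    have "((\<lambda>x::real. exp (- exp x)) \<longlongrightarrow> 0) at_top"
      by (intro filterlim_compose[OF exp_at_bot] filterlim_compose[OF filterlim_uminus_at_bot_at_top exp_at_top])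
    from tendsto_of_real[OF this, where 'a = complex] show ?thesis
      by (simp only: exp_of_real[symmetric] of_real_minus of_real_0)
  qed
  have E1: "((\<lambda>x::real. E (of_real x) $ i $ k) \<longlongrightarrow> 0) at_top" for i k
    using E0[of 0 i k] by simp
  have E2: "((\<lambda>x::real. E (of_real x - \<i> * pi) $ i $ k) \<longlongrightarrow> 0) at_top" for i k
    using E0[of "- pi" i k] by simp
  show ?A
  proof (cases "j = 3")
    case True
    have "((\<lambda>x::real. ?r * (1 + E (of_real x) $ 3 $ 3)) \<longlongrightarrow> ?r * (1 + 0)) at_top"
      by (intro tendsto_intros E1)
    also have "(\<lambda>x::real. ?r * (1 + E (of_real x) $ 3 $ 3))
        = (\<lambda>x. exp (- exp (of_real x)) * (Y (of_real x) $ 1 $ j + Y (of_real x) $ 3 $ j))"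
      unfolding u ME using True by (simp add: fun_eq_iff exp_minus)
    finally show ?thesis using True by simp
  next
    case False
    have "((\<lambda>x::real. exp (- exp (of_real x)) * (?r * E (of_real x) $ 3 $ j)) \<longlongrightarrow> 0 * (?r * 0)) at_top"
      by (intro tendsto_intros E1 neg)
    with False show ?thesis by (simp add: u ME)
  qed
  have expi: "exp (of_real x - \<i> * pi) = - exp (of_real x :: complex)" for x by (simp add: exp_diff)
  have M_lim: "((\<lambda>x::real. M (of_real x - \<i> * pi) $ i $ j) \<longlongrightarrow> (if i = j \<and> j \<noteq> 3 then 1 else 0)) at_top" for i
  proof (cases "j = 3")
    case True
    have "((\<lambda>x::real. ((if i = j then 1 else 0) + E (of_real x - \<i> * pi) $ i $ j) * exp (- exp (of_real x)))
        \<longlongrightarrow> ((if i = j then 1 else 0) + 0) * 0) at_top"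
      by (intro tendsto_intros E2 neg)
    then show ?thesis unfolding ME using True by (simp add: expi)
  next
    case False
    have "((\<lambda>x::real. ((if i = j then 1 else 0) + E (of_real x - \<i> * pi) $ i $ j))
        \<longlongrightarrow> ((if i = j then 1 else 0) + 0)) at_top"
      by (intro tendsto_intros E2)
    with False show ?thesis by (simp add: ME)
  qed
  have "((\<lambda>x::real. - \<i> * ?r * (s * M (of_real x - \<i> * pi) $ 1 $ j + t * M (of_real x - \<i> * pi) $ 2 $ j)) \<longlongrightarrow>
    - \<i> * ?r * (s * (if 1 = j \<and> j \<noteq> 3 then 1 else 0) + t * (if 2 = j \<and> j \<noteq> 3 then 1 else 0))) at_top"
    by (intro tendsto_intros M_lim)
  then show ?B unfolding v using exhaust_3[of j] by auto
  have "((\<lambda>x::real. Y (of_real x - \<i> * pi) $ 2 $ j) \<longlongrightarrow>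
    s * (if 2 = j \<and> j \<noteq> 3 then 1 else 0) - t * (if 1 = j \<and> j \<noteq> 3 then 1 else 0)) at_top"
    unfolding y2 by (intro tendsto_intros M_lim)
  moreover have "((\<lambda>x::real. Y (of_real x - \<i> * pi) $ 2 $ j) \<longlongrightarrow> Y \<zeta> $ 2 $ j) at_top"
    using fundamental_solution_second_row[OF F] by (intro tendsto_eventually always_eventually) metis
  ultimately have "Y \<zeta> $ 2 $ j = s * (if 2 = j \<and> j \<noteq> 3 then 1 else 0) - t * (if 1 = j \<and> j \<noteq> 3 then 1 else 0)"
    using tendsto_unique[OF trivial_limit_at_top_linorder] by blast
  then show ?C using exhaust_3[of j] by auto
qed

section \<open>Gamma factors\<close>

text \<open>The cosines cancel, and Legendre's formula at \<open>1/2 + \<mu>\<close> removes the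
  Gamma values. Thus the factor in the claimed entries inverts, up to \<open>sqrt 2\<close>, the
  coefficient arising from the linear equations.\<close>

lemma Gamma_quotient_times_cos:
  fixes \<mu> :: complex
  assumes \<mu>: "2 * \<mu> \<notin> \<int>"
  shows "Gamma (1 + 2 * \<mu>) / Gamma (1 + \<mu>) * (2 * cos (\<mu> * of_real pi)) *
    (of_real (sqrt (2 * pi)) / 2 powr (1 + 2 * \<mu>) * ((1 / cos (\<mu> * of_real pi)) / Gamma (1/2 + \<mu>)))
    = of_real (sqrt 2)"
proof -
  have Int: "z \<notin> \<int>\<^sub>\<le>\<^sub>0" if "2 * z = 2 * \<mu> + of_int k" for z k
  proof
    assume "z \<in> \<int>\<^sub>\<le>\<^sub>0"
    from Ints_diff[OF Ints_mult[OF Ints_numeral nonpos_Ints_Int[OF this]] Ints_of_int, of "num.Bit0 num.One" k] \<mu>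
    show False by (simp add: that)
  qed
  have i1: "1/2 + \<mu> \<notin> \<int>\<^sub>\<le>\<^sub>0" using Int[of _ 1] by simp
  have i2: "1 + \<mu> \<notin> \<int>\<^sub>\<le>\<^sub>0" using Int[of _ 2] by simp
  have i3: "1 + 2 * \<mu> \<notin> \<int>\<^sub>\<le>\<^sub>0"
  proof
    assume "1 + 2 * \<mu> \<in> \<int>\<^sub>\<le>\<^sub>0"
    from Ints_diff[OF nonpos_Ints_Int[OF this] Ints_1] \<mu> show False by simp
  qed
  \<comment> \<open>A zero of the cosine would make \<open>2 * \<mu>\<close> an odd integer.\<close>
  have c: "cos (\<mu> * of_real pi) \<noteq> 0"
  proof
    assume "cos (\<mu> * of_real pi) = 0"
    then obtain n :: int where "\<mu> * of_real pi = of_real (n * pi) + of_real pi / 2"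
      unfolding cos_eq_0 by auto
    then have "(2 * \<mu>) * of_real pi = of_int (2 * n + 1) * of_real pi" by (simp add: field_simps)
    then have "2 * \<mu> = of_int (2 * n + 1)" by (metis mult_cancel_right of_real_eq_0_iff pi_neq_zero)
    with \<mu> show False by simp
  qed
  note nz = i1[THEN Gamma_nonzero] i2[THEN Gamma_nonzero] i3[THEN Gamma_nonzero] 
  have "Gamma (1/2 + \<mu>) * Gamma (1/2 + \<mu> + 1/2)
      = exp ((1 - 2 * (1/2 + \<mu>)) * of_real (ln 2)) * of_real (sqrt pi) * Gamma (2 * (1/2 + \<mu>))"
    using i1 i2 by (intro Gamma_legendre_duplication) auto
  moreover have "1/2 + \<mu> + 1/2 = 1 + \<mu>" "2 * (1/2 + \<mu>) = 1 + 2 * \<mu>" by (simp_all add: field_simps)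
  moreover have "exp ((1 - (1 + 2 * \<mu>)) * of_real (ln 2)) = 2 / 2 powr (1 + 2 * \<mu>)"
    by (simp add: powr_def Ln_of_real[of 2, simplified] ring_distribs exp_add exp_minus exp_of_real field_simps)
  ultimately have dup: "Gamma (1/2 + \<mu>) * Gamma (1 + \<mu>) = 2 / 2 powr (1 + 2 * \<mu>) * of_real (sqrt pi) * Gamma (1 + 2 * \<mu>)"
    by simp
  have "of_real (sqrt (2 * pi)) = (of_real (sqrt 2) * of_real (sqrt pi) :: complex)"
    by (simp add: real_sqrt_mult)
  then have "Gamma (1 + 2 * \<mu>) / Gamma (1 + \<mu>) * (2 * cos (\<mu> * of_real pi)) *
    (of_real (sqrt (2 * pi)) / 2 powr (1 + 2 * \<mu>) * ((1 / cos (\<mu> * of_real pi)) / Gamma (1/2 + \<mu>)))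
    = of_real (sqrt 2) * (2 / 2 powr (1 + 2 * \<mu>) * of_real (sqrt pi) * Gamma (1 + 2 * \<mu>)) / (Gamma (1/2 + \<mu>) * Gamma (1 + \<mu>))"
    using c by (simp add: mult_ac)
  also have "\<dots> = of_real (sqrt 2)"
    unfolding dup[symmetric] using nz by simp
  finally show ?thesis .
qed

section \<open>Solving for the entries\<close>

theorem mainTheorem4:
  fixes \<mu> y0' s t :: complex
    and Y0 Y1 :: "complex \<Rightarrow> complex^3^3"
  assumes "2 * \<mu> \<notin> \<int>"
    and "y0' \<noteq> 0" and "y0' \<noteq> 1"
    and "s\<^sup>2 = y0'" and "t\<^sup>2 = 1 - y0'"
    and "fundamental_solution_at_0 \<mu> Y0"
    and "fundamental_solution_at_infinity \<mu> s t Y1"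
  shows "let C = connection_matrix Y0 Y1 in
      (\<forall>\<zeta>. Y1 \<zeta> = Y0 \<zeta> ** C)
    \<and> C $ 1 $ 1 = - \<i> * (of_real (sqrt (2 * pi)) * s / 2 powr (1 + 2 * \<mu>))
                     * ((1 / cos (\<mu> * of_real pi)) / Gamma (1/2 + \<mu>))
    \<and> C $ 1 $ 2 = - \<i> * (of_real (sqrt (2 * pi)) * t / 2 powr (1 + 2 * \<mu>))
                     * ((1 / cos (\<mu> * of_real pi)) / Gamma (1/2 + \<mu>))
    \<and> C $ 1 $ 3 = (of_real (sqrt (2 * pi)) / 2 powr (1 + 2 * \<mu>))
                     * ((1 / cos (\<mu> * of_real pi)) / Gamma (1/2 + \<mu>))
                     * exp (\<i> * \<mu> * of_real pi)
    \<and> C $ 2 $ 1 = - t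
    \<and> C $ 2 $ 2 = s
    \<and> C $ 2 $ 3 = 0
    \<and> C $ 3 $ 1 = \<i> * (1 - 2 * \<mu>) * (of_real (sqrt (2 * pi)) * s / 2 powr (2 * (1 - \<mu>)))
                     * ((1 / cos (\<mu> * of_real pi)) / Gamma (3/2 - \<mu>))
    \<and> C $ 3 $ 2 = \<i> * (1 - 2 * \<mu>) * (of_real (sqrt (2 * pi)) * t / 2 powr (2 * (1 - \<mu>)))
                     * ((1 / cos (\<mu> * of_real pi)) / Gamma (3/2 - \<mu>))
    \<and> C $ 3 $ 3 = (1 - 2 * \<mu>) * (of_real (sqrt (2 * pi)) / 2 powr (2 * (1 - \<mu>)))
                     * ((1 / cos (\<mu> * of_real pi)) / Gamma (3/2 - \<mu>))
                     * exp (- \<i> * \<mu> * of_real pi)"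
proof -
  note \<mu> = assms(1) and Y0 = assms(6) and Y1 = assms(7)
  have \<mu>': "2 * (- \<mu>) \<notin> \<int>" using \<mu> by simp
  have st: "s\<^sup>2 + t\<^sup>2 = 1" using assms(4,5) by simp
  obtain C where C: "\<And>\<zeta>. Y1 \<zeta> = Y0 \<zeta> ** C"
    using connection_matrix_exists[OF \<mu> Y0] Y1 by (auto simp: fundamental_solution_at_infinity_def)
  have conn: "connection_matrix Y0 Y1 = C"
    using Y0 by (intro connection_matrix_eq C)
      (auto simp: fundamental_solution_at_0_def fundamental_solution_def)
  note y0 = fundamental_solution_at_0_entries[OF \<mu> Y0]
  have C1: "Y1 \<zeta> $ i $ j = Y0 \<zeta> $ i $ 1 * C $ 1 $ j + Y0 \<zeta> $ i $ 2 * C $ 2 $ j + Y0 \<zeta> $ i $ 3 * C $ 3 $ j" for \<zeta> i j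
    unfolding C by (simp add: matrix_matrix_mult_def sum_3)
  have C2: "C $ 2 $ j = (if j = 1 then - t else if j = 2 then s else 0)" for j
    using fundamental_solution_at_infinity_limits(3)[OF Y1 st, of 0 j] C1[of 0 2 j] by (simp add: y0(6,8,9))
  define A where "A = Gamma (1 + 2 * \<mu>) / Gamma (1 + \<mu>)"
  define B where "B = Gamma (1 + 2 * (- \<mu>)) / Gamma (1 + - \<mu>)"
  let ?e = "exp (\<i> * \<mu> * of_real pi)" and ?e' = "exp (- \<i> * \<mu> * of_real pi)"
  let ?c = "2 * cos (\<mu> * of_real pi)"
  let ?r = "of_real (sqrt 2) :: complex"
  \<comment> \<open>Up to the factor \<open>sqrt 2\<close>, \<open>\<alpha>\<close> and
    \<open>\<beta>\<close> are the limits of column \<open>j\<close> on the rays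
    \<open>arg z = 0\<close> and \<open>arg z = - pi\<close>.\<close>
  define \<alpha> where "\<alpha> j = (if j = 3 then 1 else 0 :: complex)" for j :: 3
  define \<beta> where "\<beta> j = - \<i> * (if j = 1 then s else if j = 2 then t else 0)" for j :: 3
  let ?f = "\<lambda>\<nu> (x::real). exp (- exp (of_real x)) * exp (\<nu> * of_real x) * eval_fps (kummer_fps \<nu>) (exp (of_real x)) :: complex"
  have f: "(?f \<mu> \<longlongrightarrow> A) at_top" "(?f (- \<mu>) \<longlongrightarrow> B) at_top"
    unfolding A_def B_def by (rule kummer_fps_tendsto[OF \<mu>] kummer_fps_tendsto[OF \<mu>'])+
  have eq1: "C $ 1 $ j * A + C $ 3 $ j * B = ?r * \<alpha> j" for j
  proof -
    have "((\<lambda>x. C $ 1 $ j * ?f \<mu> x + C $ 3 $ j * ?f (- \<mu>) x) \<longlongrightarrow> C $ 1 $ j * A + C $ 3 $ j * B) at_top"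
        (is "(_ \<longlongrightarrow> ?L) _")
      by (intro tendsto_intros f)
    also have "(\<lambda>x. C $ 1 $ j * ?f \<mu> x + C $ 3 $ j * ?f (- \<mu>) x)
        = (\<lambda>x. exp (- exp (of_real x)) * (Y1 (of_real x) $ 1 $ j + Y1 (of_real x) $ 3 $ j))"
        (is "_ = ?Y")
    proof
      fix x :: real
      let ?z = "of_real x :: complex"
      have "Y1 ?z $ 1 $ j + Y1 ?z $ 3 $ j
          = C $ 1 $ j * (Y0 ?z $ 1 $ 1 + Y0 ?z $ 3 $ 1) + C $ 3 $ j * (Y0 ?z $ 1 $ 3 + Y0 ?z $ 3 $ 3)"
        by (simp add: C1 y0(5,7) algebra_simps)
      then show "C $ 1 $ j * ?f \<mu> x + C $ 3 $ j * ?f (- \<mu>) x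
          = exp (- exp ?z) * (Y1 ?z $ 1 $ j + Y1 ?z $ 3 $ j)"
        unfolding y0(1,2) by (simp add: algebra_simps)
    qed
    finally have lim: "(?Y \<longlongrightarrow> ?L) at_top" .
    from tendsto_unique[OF trivial_limit_at_top_linorder lim fundamental_solution_at_infinity_limits(1)[OF Y1 st, of j]]
    show ?thesis by (simp add: \<alpha>_def)
  qed
  \<comment> \<open>The minus sign arises because column 3 has its known limit for
    \<open>- q\<close>; the factors \<open>?e'\<close> and \<open>?e\<close> come from the half
    turn.\<close>
  have eq2: "C $ 1 $ j * (?e' * A) - C $ 3 $ j * (?e * B) = ?r * \<beta> j" for j
  proof -
    have "((\<lambda>x. C $ 1 $ j * (?e' * ?f \<mu> x) - C $ 3 $ j * (?e * ?f (- \<mu>) x))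
        \<longlongrightarrow> C $ 1 $ j * (?e' * A) - C $ 3 $ j * (?e * B)) at_top"
        (is "(_ \<longlongrightarrow> ?L) _")
      by (intro tendsto_intros f)
    also have "(\<lambda>x. C $ 1 $ j * (?e' * ?f \<mu> x) - C $ 3 $ j * (?e * ?f (- \<mu>) x))
        = (\<lambda>x. Y1 (of_real x - \<i> * pi) $ 1 $ j - Y1 (of_real x - \<i> * pi) $ 3 $ j)"
        (is "_ = ?Y")
    proof
      fix x :: real
      let ?z = "of_real x - \<i> * pi :: complex"
      have "Y1 ?z $ 1 $ j - Y1 ?z $ 3 $ j
          = C $ 1 $ j * (Y0 ?z $ 1 $ 1 - Y0 ?z $ 3 $ 1) - C $ 3 $ j * (Y0 ?z $ 3 $ 3 - Y0 ?z $ 1 $ 3)"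
        by (simp add: C1 y0(5,7) algebra_simps)
      then show "C $ 1 $ j * (?e' * ?f \<mu> x) - C $ 3 $ j * (?e * ?f (- \<mu>) x)
          = Y1 ?z $ 1 $ j - Y1 ?z $ 3 $ j"
        unfolding y0(3,4) by (simp add: mult_ac)
    qed
    finally have lim: "(?Y \<longlongrightarrow> ?L) at_top" .
    from tendsto_unique[OF trivial_limit_at_top_linorder lim fundamental_solution_at_infinity_limits(2)[OF Y1 st, of j]]
    show ?thesis by (simp add: \<beta>_def)
  qed
  have ee: "?e * ?e' = 1" by (simp flip: exp_add)
  have ec: "?e + ?e' = ?c" by (simp add: cos_exp_eq mult_ac)
  \<comment> \<open>Adding \<open>?e\<close> times \<open>eq1\<close> to \<open>eq2\<close>
    eliminates the third row; \<open>C3B\<close> likewise eliminates the first by subtracting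
    \<open>eq2\<close> from \<open>?e'\<close> times \<open>eq1\<close>.\<close>
  have C1A: "C $ 1 $ j * (A * ?c) = ?r * (\<alpha> j * ?e + \<beta> j)" for j
  proof -
    have "C $ 1 $ j * (A * (?e + ?e')) = (C $ 1 $ j * A + C $ 3 $ j * B) * ?e + (C $ 1 $ j * (?e' * A) - C $ 3 $ j * (?e * B))"
      by (simp add: algebra_simps)
    then show ?thesis unfolding ec eq1 eq2 by (simp add: algebra_simps)
  qed
  have C3B: "C $ 3 $ j * (B * ?c) = ?r * (\<alpha> j * ?e' - \<beta> j)" for j
  proof -
    have "C $ 3 $ j * (B * (?e + ?e')) = (C $ 1 $ j * A + C $ 3 $ j * B) * ?e' - (C $ 1 $ j * (?e' * A) - C $ 3 $ j * (?e * B))"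
      by (simp add: algebra_simps)
    then show ?thesis unfolding ec eq1 eq2 by (simp add: algebra_simps)
  qed
  define g where "g \<nu> = of_real (sqrt (2 * pi)) / 2 powr (1 + 2 * \<nu>) *
     ((1 / cos (\<nu> * of_real pi)) / Gamma (1/2 + \<nu>))" for \<nu> :: complex
  have gA: "A * ?c * g \<mu> = ?r"
    using Gamma_quotient_times_cos[OF \<mu>] unfolding A_def g_def .
  have gB: "B * ?c * g (- \<mu>) = ?r"
    using Gamma_quotient_times_cos[OF \<mu>'] unfolding B_def g_def by simp
  have r0: "?r \<noteq> 0" by simp
  have C1g: "C $ 1 $ j = (\<alpha> j * ?e + \<beta> j) * g \<mu>" for j
  proof -
    have "?r * C $ 1 $ j = ?r * ((\<alpha> j * ?e + \<beta> j) * g \<mu>)"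
    proof -
      have "?r * C $ 1 $ j = C $ 1 $ j * (A * ?c) * g \<mu>"
        by (subst gA[symmetric]) (simp only: mult.assoc mult.commute mult.left_commute)
      then show ?thesis unfolding C1A by (simp only: mult.assoc)
    qed
    then show ?thesis by (simp only: mult_left_cancel[OF r0])
  qed
  have C3g: "C $ 3 $ j = (\<alpha> j * ?e' - \<beta> j) * g (- \<mu>)" for j
  proof -
    have "?r * C $ 3 $ j = ?r * ((\<alpha> j * ?e' - \<beta> j) * g (- \<mu>))"
    proof -
      have "?r * C $ 3 $ j = C $ 3 $ j * (B * ?c) * g (- \<mu>)"
        by (subst gB[symmetric]) (simp only: mult.assoc mult.commute mult.left_commute)
      then show ?thesis unfolding C3B by (simp only: mult.assoc)
    qed
    then show ?thesis by (simp only: mult_left_cancel[OF r0])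
  qed
  have c1: "C $ 1 $ 1 = - \<i> * s * g \<mu>" "C $ 1 $ 2 = - \<i> * t * g \<mu>" "C $ 1 $ 3 = ?e * g \<mu>"
    unfolding C1g by (simp_all add: \<alpha>_def \<beta>_def)
  have c3: "C $ 3 $ 1 = \<i> * s * g (- \<mu>)" "C $ 3 $ 2 = \<i> * t * g (- \<mu>)" "C $ 3 $ 3 = ?e' * g (- \<mu>)"
    unfolding C3g by (simp_all add: \<alpha>_def \<beta>_def)
  \<comment> \<open>The third row is stated with
    \<open>Gamma (3/2 - \<mu>) = (1/2 - \<mu>) * Gamma (1/2 - \<mu>)\<close>; this and one more
    power of 2 in the denominator produce the factor \<open>1 - 2 * \<mu>\<close>.\<close>
  have g': "g (- \<mu>) = (1 - 2 * \<mu>) * (of_real (sqrt (2 * pi)) / 2 powr (2 * (1 - \<mu>)))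
                     * ((1 / cos (\<mu> * of_real pi)) / Gamma (3/2 - \<mu>))"
  proof -
    have nonpos: "1/2 - \<mu> \<notin> \<int>\<^sub>\<le>\<^sub>0"
    proof
      assume "1/2 - \<mu> \<in> \<int>\<^sub>\<le>\<^sub>0"
      from Ints_diff[OF Ints_1 Ints_mult[OF Ints_numeral nonpos_Ints_Int[OF this]], of "num.Bit0 num.One"]
      have "2 * \<mu> \<in> \<int>" by (simp add: algebra_simps)
      with \<mu> show False ..
    qed
    then have h: "1/2 - \<mu> \<noteq> 0" by (metis zero_in_nonpos_Ints)
    have G: "Gamma (3/2 - \<mu>) = (1/2 - \<mu>) * Gamma (1/2 - \<mu>)"
      using Gamma_plus1[OF nonpos] by (simp add: algebra_simps)
    have P: "2 powr (2 * (1 - \<mu>)) = 2 * 2 powr (1 - 2 * \<mu>)"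
    proof -
      have "2 * (1 - \<mu>) = 1 + (1 - 2 * \<mu>)" by simp
      then show ?thesis by (simp only: powr_add) simp
    qed
    have two: "2 * (1/2 - \<mu>) = 1 - 2 * \<mu>" by simp
    have gm: "g (- \<mu>) = of_real (sqrt (2 * pi)) / 2 powr (1 - 2 * \<mu>) *
        ((1 / cos (\<mu> * of_real pi)) / Gamma (1/2 - \<mu>))"
      by (simp add: g_def)
    have "S / X * (c / D) = (2 * w) * (S / (2 * X)) * (c / (w * D))" if "w \<noteq> 0" for S X c D w :: complex
      using that by simp
    from this[OF h] show ?thesis unfolding gm G P by (simp only: two)
  qed
  show ?thesis
    unfolding conn Let_def using C
    by (simp add: c1 c3 C2 g') (simp add: g_def mult_ac)
qed

end
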